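(* Let $(A,\mathfrak{m})$ be a Cohen–Macaulay local domain of dimension $d\geq 1$ and let $I$ be a non-zero ideal of $A$. Let $J\subseteq S$ and $\widehat{J}\subseteq\widehat{S}$ be the defining ideals of the Rees algebra $\mathcal{R}(I)=A[It]$ and of the extended Rees algebra $\widehat{\mathcal{R}}(I)=A[It,t^{-1}]$ (see context). Then (1) $\operatorname{rank}_{\widehat{\mathcal{R}}(I)}H_1(\widehat{J})=\mu(\widehat{J})-\mu(I)$; (2) $\operatorname{rank}_{\mathcal{R}(I)}H_1(J)=\mu(J)-\mu(I)+1$.
   Context: Write $I=(a_1,\ldots,a_r)$ minimally, so $r=\mu(I)$. Let $S=A[X_1,\ldots,X_r]$ with $\deg A=0$, $\deg X_i=1$, and let $J$ be the kernel of the graded $A$-algebra map $S\to\mathcal{R}(I)$, $X_i\mapsto a_it$. Let $\widehat{S}=A[X_1,\ldots,X_r,T]$ with $\deg A=0$, $\deg X_i=1$, $\deg T=-1$, and let $\widehat{J}$ be the kernel of the graded $A$-algebra map $\widehat{S}\to\widehat{\mathcal{R}}(I)$, $X_i\mapsto a_it$, $T\mapsto t^{-1}$. $\mu$ denotes the minimal number of generators (homogeneous ones, for the graded ideals $J$, $\widehat{J}$). $H_1(J)$ (resp. $H_1(\widehat{J})$) is the first Koszul homology over $S$ (resp. $\widehat{S}$) of a minimal system of $\mu(J)$ (resp. $\mu(\widehat{J})$) homogeneous generators of $J$ (resp. $\widehat{J}$); it is a module over the domain $S/J=\mathcal{R}(I)$ (resp. $\widehat{S}/\widehat{J}=\widehat{\mathcal{R}}(I)$).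 The rank of a finitely generated module over a domain is the dimension of its localization at the zero ideal. *)

theory Defs
  imports
    "HOL-Algebra.Ring_Divisibility"
    "HOL-Algebra.Generated_Rings"
    "HOL-Library.Poly_Mapping"
    "HOL-Library.Extended_Nat"
    "Jordan_Normal_Form.VS_Connect"
begin

section \<open>Cohen--Macaulay local rings\<close>

definition krull_dim :: "('r, 'x) ring_scheme \<Rightarrow> enat" where
  "krull_dim R =
     (SUP n\<in>{n. \<exists>P. (\<forall>i\<le>n. primeideal (P i) R) \<and> (\<forall>i<n. P i \<subset> P (Suc i))}. enat n)"

definition regular_sequence :: "('r, 'x) ring_scheme \<Rightarrow> 'r list \<Rightarrow> bool" where
  "regular_sequence R xs \<longleftrightarrow>
     set xs \<subseteq> carrier R \<and> Idl\<^bsub>R\<^esub> (set xs) \<noteq> carrier R \<and>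
     (\<forall>i<length xs. \<forall>y\<in>carrier R.
        y \<otimes>\<^bsub>R\<^esub> xs ! i \<in> Idl\<^bsub>R\<^esub> (set (take i xs)) \<longrightarrow> y \<in> Idl\<^bsub>R\<^esub> (set (take i xs)))"

definition depth :: "('r, 'x) ring_scheme \<Rightarrow> 'r set \<Rightarrow> enat" where
  "depth R \<mm> = (SUP xs\<in>{xs. regular_sequence R xs \<and> set xs \<subseteq> \<mm>}. enat (length xs))"

definition cohen_macaulay_local :: "('r, 'x) ring_scheme \<Rightarrow> 'r set \<Rightarrow> bool" where
  "cohen_macaulay_local R \<mm> \<longleftrightarrow>
     cring R \<and> noetherian_ring R \<and> {M. maximalideal M R} = {\<mm>} \<and> depth R \<mm> = krull_dim R"


section \<open>Numbers of generators\<close>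

text \<open>The generators are required to lie in \<open>H\<close>: the whole carrier for the usual minimal number
  of generators, the set of homogeneous elements for graded ideals.\<close>

definition min_num_gens :: "('r, 'x) ring_scheme \<Rightarrow> 'r set \<Rightarrow> 'r set \<Rightarrow> nat" where
  "min_num_gens R H I = (LEAST n. \<exists>B\<subseteq>H. finite B \<and> card B = n \<and> Idl\<^bsub>R\<^esub> B = I)"

definition min_gen_system :: "('r, 'x) ring_scheme \<Rightarrow> 'r set \<Rightarrow> 'r set \<Rightarrow> 'r list \<Rightarrow> bool" where
  "min_gen_system R H I fs \<longleftrightarrow>
     set fs \<subseteq> H \<and> Idl\<^bsub>R\<^esub> (set fs) = I \<and> length fs = min_num_gens R H I"


section \<open>Localization at a prime ideal, and rank\<close>

text \<open>\<open>M\<^bsub>P\<^esub>\<close> consists of classes of pairs \<open>(x, s)\<close>, read as fractions \<open>x/s\<close>. An operation on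
  classes is the union of its values on all representatives; these values coincide, so
  the union is again a single class (as in \<^const>\<open>rcoset_mult\<close>).\<close>

definition loc_rel ::
  "('r, 'x) ring_scheme \<Rightarrow> 'r set \<Rightarrow> ('r, 'm, 'y) module_scheme \<Rightarrow> (('m \<times> 'r) \<times> ('m \<times> 'r)) set" where
  "loc_rel R P M =
     {((x, s), (y, t)). x \<in> carrier M \<and> y \<in> carrier M \<and> s \<in> carrier R - P \<and> t \<in> carrier R - P \<and>
        (\<exists>u\<in>carrier R - P. u \<odot>\<^bsub>M\<^esub> (t \<odot>\<^bsub>M\<^esub> x) = u \<odot>\<^bsub>M\<^esub> (s \<odot>\<^bsub>M\<^esub> y))}"

definition loc_frac ::
  "('r, 'x) ring_scheme \<Rightarrow> 'r set \<Rightarrow> ('r, 'm, 'y) module_scheme \<Rightarrow> 'm \<Rightarrow> 'r \<Rightarrow> ('m \<times> 'r) set" where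
  "loc_frac R P M x s = loc_rel R P M `` {(x, s)}"

definition self_module :: "('r, 'x) ring_scheme \<Rightarrow> ('r, 'r) module" where
  "self_module R =
     \<lparr>carrier = carrier R, mult = mult R, one = \<one>\<^bsub>R\<^esub>, zero = \<zero>\<^bsub>R\<^esub>, add = add R, smult = mult R\<rparr>"

definition loc_ring :: "('r, 'x) ring_scheme \<Rightarrow> 'r set \<Rightarrow> ('r \<times> 'r) set ring" where
  "loc_ring R P =
     \<lparr>carrier = (carrier R \<times> (carrier R - P)) // loc_rel R P (self_module R),
      mult = (\<lambda>\<alpha> \<beta>. \<Union>(a, s)\<in>\<alpha>. \<Union>(b, t)\<in>\<beta>.
                loc_frac R P (self_module R) (a \<otimes>\<^bsub>R\<^esub> b) (s \<otimes>\<^bsub>R\<^esub> t)),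
      one = loc_frac R P (self_module R) \<one>\<^bsub>R\<^esub> \<one>\<^bsub>R\<^esub>,
      zero = loc_frac R P (self_module R) \<zero>\<^bsub>R\<^esub> \<one>\<^bsub>R\<^esub>,
      add = (\<lambda>\<alpha> \<beta>. \<Union>(a, s)\<in>\<alpha>. \<Union>(b, t)\<in>\<beta>.
               loc_frac R P (self_module R) (t \<otimes>\<^bsub>R\<^esub> a \<oplus>\<^bsub>R\<^esub> s \<otimes>\<^bsub>R\<^esub> b) (s \<otimes>\<^bsub>R\<^esub> t))\<rparr>"

text \<open>The fields \<open>mult\<close> and \<open>one\<close> play no role in a module record.\<close>

definition loc_module ::
  "('r, 'x) ring_scheme \<Rightarrow> 'r set \<Rightarrow> ('r, 'm, 'y) module_scheme \<Rightarrow>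
     (('r \<times> 'r) set, ('m \<times> 'r) set) module" where
  "loc_module R P M =
     \<lparr>carrier = (carrier M \<times> (carrier R - P)) // loc_rel R P M,
      mult = undefined, one = undefined,
      zero = loc_frac R P M \<zero>\<^bsub>M\<^esub> \<one>\<^bsub>R\<^esub>,
      add = (\<lambda>\<alpha> \<beta>. \<Union>(x, s)\<in>\<alpha>. \<Union>(y, t)\<in>\<beta>.
               loc_frac R P M (t \<odot>\<^bsub>M\<^esub> x \<oplus>\<^bsub>M\<^esub> s \<odot>\<^bsub>M\<^esub> y) (s \<otimes>\<^bsub>R\<^esub> t)),
      smult = (\<lambda>\<alpha> \<beta>. \<Union>(a, s)\<in>\<alpha>. \<Union>(x, t)\<in>\<beta>. loc_frac R P M (a \<odot>\<^bsub>M\<^esub> x) (s \<otimes>\<^bsub>R\<^esub> t))\<rparr>"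

definition module_rank :: "('r, 'x) ring_scheme \<Rightarrow> ('r, 'm, 'y) module_scheme \<Rightarrow> nat" where
  "module_rank R M = vectorspace.dim (loc_ring R {\<zero>\<^bsub>R\<^esub>}) (loc_module R {\<zero>\<^bsub>R\<^esub>} M)"


section \<open>Koszul homology\<close>

text \<open>For \<open>fs = [f\<^sub>0, \<dots>, f\<^sub>n\<^sub>-\<^sub>1]\<close> the degree \<open>p\<close> part of the Koszul complex is free on the basis
  elements \<open>e\<^sub>U\<close> with \<open>U \<subseteq> {0..<n}\<close> and \<open>card U = p\<close>; a chain is given by its coordinates
  \<open>U \<mapsto> z U\<close>. The differential is
  \<open>e\<^sub>V \<mapsto> \<Sum>i\<in>V. (-1) ^ card {j \<in> V. j < i} * f\<^sub>i * e\<^sub>V\<^sub>-\<^sub>i\<close>, written out below on coordinates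
  (with \<open>V = insert i U\<close>).\<close>

definition koszul_chains :: "'s::comm_ring_1 list \<Rightarrow> nat \<Rightarrow> (nat set \<Rightarrow> 's) set" where
  "koszul_chains fs p = {z. \<forall>U. z U \<noteq> 0 \<longrightarrow> U \<subseteq> {..<length fs} \<and> card U = p}"

definition koszul_diff :: "'s::comm_ring_1 list \<Rightarrow> (nat set \<Rightarrow> 's) \<Rightarrow> nat set \<Rightarrow> 's" where
  "koszul_diff fs z U =
     (\<Sum>i\<in>{..<length fs} - U. (-1) ^ card {j \<in> U. j < i} * fs ! i * z (insert i U))"

definition koszul_cycles :: "'s::comm_ring_1 list \<Rightarrow> nat \<Rightarrow> ('s, nat set \<Rightarrow> 's) module" where
  "koszul_cycles fs p =
     \<lparr>carrier = {z \<in> koszul_chains fs p. koszul_diff fs z = (\<lambda>_. 0)},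
      mult = undefined, one = undefined,
      zero = (\<lambda>_. 0), add = (\<lambda>z w U. z U + w U), smult = (\<lambda>c z U. c * z U)\<rparr>"

definition koszul_boundaries :: "'s::comm_ring_1 list \<Rightarrow> nat \<Rightarrow> (nat set \<Rightarrow> 's) set" where
  "koszul_boundaries fs p = koszul_diff fs ` koszul_chains fs (Suc p)"

text \<open>Koszul homology is annihilated by the ideal generated by \<open>fs\<close>; here it carries its structure
  of a module over the quotient ring \<open>class_ring Quot Idl (set fs)\<close>, so scalars are cosets.\<close>

definition koszul_homology ::
  "'s::comm_ring_1 list \<Rightarrow> nat \<Rightarrow> ('s set, (nat set \<Rightarrow> 's) set) module" where
  "koszul_homology fs p =
     (let Z = koszul_cycles fs p; B = koszul_boundaries fs p in
      \<lparr>carrier = a_rcosets\<^bsub>Z\<^esub> B, mult = undefined, one = undefined,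
       zero = B, add = set_add Z,
       smult = (\<lambda>\<gamma> h. \<Union>c\<in>\<gamma>. \<Union>z\<in>h. B +>\<^bsub>Z\<^esub> (c \<odot>\<^bsub>Z\<^esub> z))\<rparr>)"


section \<open>Rees algebras and their defining ideals\<close>

text \<open>\<open>('v, 'a) mpoly\<close> is the polynomial ring over \<open>'a\<close> in the variables \<open>X\<^sub>v\<close>, \<open>v :: 'v\<close>;
  \<open>'a laurent\<close> is the ring \<open>A[t, t\<^sup>-\<^sup>1]\<close> of Laurent polynomials, where
  \<open>Poly_Mapping.single k c\<close> is \<open>c t\<^sup>k\<close>.\<close>

type_synonym ('v, 'a) mpoly = "('v \<Rightarrow>\<^sub>0 nat) \<Rightarrow>\<^sub>0 'a"
type_synonym 'a laurent = "int \<Rightarrow>\<^sub>0 'a"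

definition mpoly_eval ::
  "('a::comm_ring_1 \<Rightarrow> 'b::comm_ring_1) \<Rightarrow> ('v::finite \<Rightarrow> 'b) \<Rightarrow> ('v, 'a) mpoly \<Rightarrow> 'b" where
  "mpoly_eval h x p =
     (\<Sum>m\<in>Poly_Mapping.keys p. h (Poly_Mapping.lookup p m) * (\<Prod>v\<in>UNIV. x v ^ Poly_Mapping.lookup m v))"

definition homogeneous :: "('v::finite \<Rightarrow> int) \<Rightarrow> ('v, 'a::comm_ring_1) mpoly set" where
  "homogeneous w =
     {p. \<exists>k. \<forall>m\<in>Poly_Mapping.keys p. (\<Sum>v\<in>UNIV. w v * int (Poly_Mapping.lookup m v)) = k}"

definition rees_algebra :: "'a::comm_ring_1 set \<Rightarrow> 'a laurent ring" where
  "rees_algebra I =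
     class_ring\<lparr>carrier := generate_ring class_ring
       (range (Poly_Mapping.single 0) \<union> Poly_Mapping.single 1 ` I)\<rparr>"

definition ext_rees_algebra :: "'a::comm_ring_1 set \<Rightarrow> 'a laurent ring" where
  "ext_rees_algebra I =
     class_ring\<lparr>carrier := generate_ring class_ring
       (range (Poly_Mapping.single 0) \<union> Poly_Mapping.single 1 ` I \<union> {Poly_Mapping.single (-1) 1})\<rparr>"

definition rees_ideal ::
  "'a::comm_ring_1 set \<Rightarrow> ('v::finite \<Rightarrow> 'a) \<Rightarrow> ('v, 'a) mpoly set" where
  "rees_ideal I a =
     a_kernel class_ring (rees_algebra I)
       (mpoly_eval (Poly_Mapping.single 0) (\<lambda>v. Poly_Mapping.single 1 (a v)))"

text \<open>In the extended case the variables are indexed by \<open>'v option\<close>: \<open>Some v\<close> stands for \<open>X\<^sub>v\<close>,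
  \<open>None\<close> for the additional variable \<open>T\<close>.\<close>

definition ext_rees_ideal ::
  "'a::comm_ring_1 set \<Rightarrow> ('v::finite \<Rightarrow> 'a) \<Rightarrow> ('v option, 'a) mpoly set" where
  "ext_rees_ideal I a =
     a_kernel class_ring (ext_rees_algebra I)
       (mpoly_eval (Poly_Mapping.single 0)
         (case_option (Poly_Mapping.single (-1) 1) (\<lambda>v. Poly_Mapping.single 1 (a v))))"

abbreviation rees_homogeneous :: "('v::finite, 'a::comm_ring_1) mpoly set" where
  "rees_homogeneous \<equiv> homogeneous (\<lambda>_. 1)"

abbreviation ext_rees_homogeneous :: "('v::finite option, 'a::comm_ring_1) mpoly set" where
  "ext_rees_homogeneous \<equiv> homogeneous (case_option (-1) (\<lambda>_. 1))"

end

(*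
Let J be the kernel of an evaluation of the polynomial ring S into Laurent polynomials, with n
generators f. At the generic point J is generated by h elements g that are linear in the X_v, plus
T X - c in the extended case: if c = a(v0) is nonzero, the elements c X_v - a(v) X_v0 (v different
from v0) and T X_v0 - c. The variables X_v can be eliminated one at a time, so every syzygy of g is,
up to a denominator outside J, a Koszul syzygy. Reduction modulo J then embeds the localization of
H_1(f) into k^n, where k is the fraction field of S/J: the image is the kernel of the surjection
k^n -> k^h that expresses f through g. Hence rank H_1(f) = n - h, with h = mu(I) - 1 for the Rees
algebra and h = mu(I) for the extended one.
*)

theory Submission
  imports Defs
begin


section \<open>Transport of vector spaces\<close>

text \<open>The classical reason for the count: over the local ring S_J the ideal is generated by
  the regular sequence g, so f may be replaced there by g followed by n - h zeros, and H_1 becomes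
  k^(n - h). The ring S_J is never formed. A ring map \<pi> from S to k with kernel J stands for it,
  and a statement over S_J becomes one over S with an explicit multiplier \<open>u\<close> such that
  \<open>\<pi> u \<noteq> 0\<close>. Exactness of g is used twice. Its syzygies have coefficients in
  J, which sends cycles of f into the kernel of k^n -> k^h and makes the expression of g through f a
  right inverse up to a unit. And they are Koszul syzygies, which makes a cycle of f with
  coefficients in J a boundary up to a multiplier. The field k is the same for both algebras: t =
  X_v0 / a(v0) modulo J, so k is the fraction field of A[t, t^-1]. As the rank is defined through
  classes of pairs, these classes have to be matched with an ordinary vector space over k before any
  dimension can be counted.\<close>

lemma field_bij_image:
  fixes \<phi> :: "'f::field \<Rightarrow> 'k" and K :: "('k, 'x) ring_scheme"
  assumes bij: "bij_betw \<phi> UNIV (carrier K)"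
    and add: "\<And>x y. \<phi> x \<oplus>\<^bsub>K\<^esub> \<phi> y = \<phi> (x + y)"
    and mult: "\<And>x y. \<phi> x \<otimes>\<^bsub>K\<^esub> \<phi> y = \<phi> (x * y)"
    and zero: "\<zero>\<^bsub>K\<^esub> = \<phi> 0" and one: "\<one>\<^bsub>K\<^esub> = \<phi> 1"
  shows "field K"
proof -
  have car: "carrier K = range \<phi>" using bij by (simp add: bij_betw_def)
  have inj: "\<phi> x = \<phi> y \<longleftrightarrow> x = y" for x y using bij by (auto simp: bij_betw_def inj_def)
  have "abelian_group K"
  proof (rule abelian_groupI)
    fix x assume "x \<in> carrier K"
    then obtain x' where "x = \<phi> x'" by (auto simp: car)
    then show "\<exists>y\<in>carrier K. y \<oplus>\<^bsub>K\<^esub> x = \<zero>\<^bsub>K\<^esub>"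
      by (intro bexI[of _ "\<phi> (- x')"]) (auto simp: car add zero)
  qed (auto simp: car add zero inj algebra_simps)
  moreover have "comm_monoid K"
    by (rule comm_monoidI) (auto simp: car mult one inj algebra_simps)
  ultimately have "cring K"
    by (intro cringI) (auto simp: car mult add inj algebra_simps)
  then show ?thesis
  proof (rule cring.cring_fieldI2)
    fix x assume "x \<in> carrier K" "x \<noteq> \<zero>\<^bsub>K\<^esub>"
    then obtain x' where "x = \<phi> x'" "x' \<noteq> 0" by (auto simp: car zero)
    then show "\<exists>y\<in>carrier K. x \<otimes>\<^bsub>K\<^esub> y = \<one>\<^bsub>K\<^esub>"
      by (intro bexI[of _ "\<phi> (inverse x')"]) (auto simp: car mult one)
  qed (simp add: zero one inj)
qed

lemma vectorspace_bij_image: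
  fixes \<phi> :: "'f::field \<Rightarrow> 'k" and K :: "'k ring"
    and g :: "'w \<Rightarrow> 'v" and W :: "('f, 'w) module" and V :: "('k, 'v) module"
  assumes K: "field K" and \<phi>: "bij_betw \<phi> UNIV (carrier K)"
    and \<phi>_add: "\<And>x y. \<phi> x \<oplus>\<^bsub>K\<^esub> \<phi> y = \<phi> (x + y)"
    and \<phi>_mult: "\<And>x y. \<phi> x \<otimes>\<^bsub>K\<^esub> \<phi> y = \<phi> (x * y)"
    and \<phi>_one: "\<one>\<^bsub>K\<^esub> = \<phi> 1"
    and W: "vectorspace class_ring W"
    and g: "bij_betw g (carrier W) (carrier V)"
    and add: "\<And>x y. x \<in> carrier W \<Longrightarrow> y \<in> carrier W \<Longrightarrow> g x \<oplus>\<^bsub>V\<^esub> g y = g (x \<oplus>\<^bsub>W\<^esub> y)"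
    and smult: "\<And>a x. x \<in> carrier W \<Longrightarrow> \<phi> a \<odot>\<^bsub>V\<^esub> g x = g (a \<odot>\<^bsub>W\<^esub> x)"
    and zero: "\<zero>\<^bsub>V\<^esub> = g \<zero>\<^bsub>W\<^esub>"
  shows "vectorspace K V"
proof -
  interpret W: vectorspace "class_ring :: 'f ring" W by fact
  interpret K: field K by fact
  have cK: "carrier K = range \<phi>" using \<phi> by (simp add: bij_betw_def)
  have cV: "carrier V = g ` carrier W" using g by (simp add: bij_betw_def)
  have sc: "a \<odot>\<^bsub>W\<^esub> x \<in> carrier W" if "x \<in> carrier W" for a x
    using W.smult_closed[of a x] that by simp
  have sl: "(a + b) \<odot>\<^bsub>W\<^esub> x = a \<odot>\<^bsub>W\<^esub> x \<oplus>\<^bsub>W\<^esub> b \<odot>\<^bsub>W\<^esub> x"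
    and ss: "(a * b) \<odot>\<^bsub>W\<^esub> x = a \<odot>\<^bsub>W\<^esub> (b \<odot>\<^bsub>W\<^esub> x)" and s1: "1 \<odot>\<^bsub>W\<^esub> x = x"
    if "x \<in> carrier W" for a b x
    using W.smult_l_distr[of a b x] W.smult_assoc1[of a b x] W.smult_one[of x] that by simp_all
  have sr: "a \<odot>\<^bsub>W\<^esub> (x \<oplus>\<^bsub>W\<^esub> y) = a \<odot>\<^bsub>W\<^esub> x \<oplus>\<^bsub>W\<^esub> a \<odot>\<^bsub>W\<^esub> y"
    if "x \<in> carrier W" "y \<in> carrier W" for a x y
    using W.smult_r_distr[of a x y] that by simp
  have "abelian_group V"
  proof (rule abelian_groupI)
    fix x assume "x \<in> carrier V"
    then obtain x' where "x = g x'" "x' \<in> carrier W" by (auto simp: cV)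
    then show "\<exists>y\<in>carrier V. y \<oplus>\<^bsub>V\<^esub> x = \<zero>\<^bsub>V\<^esub>"
      by (intro bexI[of _ "g (\<ominus>\<^bsub>W\<^esub> x')"]) (auto simp: cV add zero W.M.l_neg)
  qed (auto simp: cV add zero W.M.a_ac)
  then have "module K V"
    by (intro moduleI K.is_cring)
      (auto simp: cK cV add smult \<phi>_add \<phi>_mult \<phi>_one sc sl ss s1 sr)
  then show ?thesis using K by (simp add: vectorspace_def)
qed

text \<open>The vectors that \<open>g\<close> sends into the span of the image of \<open>A\<close>
  form a submodule containing \<open>A\<close>, hence all of \<open>V\<close>. Scalars move along
  \<phi> because the two spaces live over different fields.\<close>

lemma semilinear_image_gen_set:
  assumes V: "vectorspace K V" and W: "vectorspace L W"
    and \<phi>: "\<And>a. a \<in> carrier K \<Longrightarrow> \<phi> a \<in> carrier L"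
    and g: "g ` carrier V = carrier W"
    and add: "\<And>x y. x \<in> carrier V \<Longrightarrow> y \<in> carrier V \<Longrightarrow> g (x \<oplus>\<^bsub>V\<^esub> y) = g x \<oplus>\<^bsub>W\<^esub> g y"
    and smult: "\<And>a x. a \<in> carrier K \<Longrightarrow> x \<in> carrier V \<Longrightarrow> g (a \<odot>\<^bsub>V\<^esub> x) = \<phi> a \<odot>\<^bsub>W\<^esub> g x"
    and A: "A \<subseteq> carrier V" and span: "LinearCombinations.module.span K V A = carrier V"
  shows "LinearCombinations.module.span L W (g ` A) = carrier W"
proof -
  interpret V: vectorspace K V by fact
  interpret W: vectorspace L W by fact
  have gA: "g ` A \<subseteq> carrier W" using A g by blast
  interpret S: submodule L "W.span (g ` A)" W by (rule W.span_is_submodule[OF gA])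
  let ?N = "{x \<in> carrier V. g x \<in> W.span (g ` A)}"
  have "g \<zero>\<^bsub>V\<^esub> = \<zero>\<^bsub>W\<^esub>"
  proof -
    have "g \<zero>\<^bsub>V\<^esub> \<in> carrier W" using g by blast
    moreover have "g \<zero>\<^bsub>V\<^esub> \<oplus>\<^bsub>W\<^esub> g \<zero>\<^bsub>V\<^esub> = g \<zero>\<^bsub>V\<^esub>" using add[of "\<zero>\<^bsub>V\<^esub>" "\<zero>\<^bsub>V\<^esub>"] by simp
    ultimately show ?thesis using W.M.add.r_cancel_one by simp
  qed
  then have N: "submodule K ?N V"
  proof (unfold_locales, goal_cases)
    case (2 v w)
    then show ?case using S.m_closed[of "g v" "g w"] by (simp add: add)
  next
    case (4 c v)
    then show ?case using S.smult_closed[OF \<phi>, of c "g v"] by (simp add: smult)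
  qed auto
  have "A \<subseteq> ?N" using A W.in_own_span[OF gA] by auto
  from V.span_is_subset[OF this N] have sub: "carrier V \<subseteq> ?N" unfolding span .
  have "carrier W \<subseteq> W.span (g ` A)"
  proof
    fix y assume "y \<in> carrier W"
    then obtain x where "x \<in> carrier V" "y = g x" using g by (metis imageE)
    with sub show "y \<in> W.span (g ` A)" by auto
  qed
  then show ?thesis by (rule equalityI[OF W.span_is_subset2[OF gA]])
qed

text \<open>\<open>dim\<close> is the least size of a finite generating set, so it is enough that
  \<open>g\<close> and its inverse carry generating sets to generating sets of the same
  size.\<close>

lemma semilinear_bij_dim:
  assumes V: "vectorspace K V" and W: "vectorspace L W"
    and \<phi>: "bij_betw \<phi> (carrier K) (carrier L)" and g: "bij_betw g (carrier V) (carrier W)"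
    and add: "\<And>x y. x \<in> carrier V \<Longrightarrow> y \<in> carrier V \<Longrightarrow> g (x \<oplus>\<^bsub>V\<^esub> y) = g x \<oplus>\<^bsub>W\<^esub> g y"
    and smult: "\<And>a x. a \<in> carrier K \<Longrightarrow> x \<in> carrier V \<Longrightarrow> g (a \<odot>\<^bsub>V\<^esub> x) = \<phi> a \<odot>\<^bsub>W\<^esub> g x"
  shows "vectorspace.dim L W = vectorspace.dim K V"
proof -
  interpret V: vectorspace K V by fact
  interpret W: vectorspace L W by fact
  define h where "h = inv_into (carrier V) g"
  define \<psi> where "\<psi> = inv_into (carrier K) \<phi>"
  have h: "bij_betw h (carrier W) (carrier V)" unfolding h_def by (rule bij_betw_inv_into[OF g])
  have \<psi>: "bij_betw \<psi> (carrier L) (carrier K)" unfolding \<psi>_def by (rule bij_betw_inv_into[OF \<phi>])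
  have hg: "h (g x) = x" if "x \<in> carrier V" for x
    unfolding h_def using bij_betw_inv_into_left[OF g that] .
  have cW: "carrier W = g ` carrier V" and cL: "carrier L = \<phi> ` carrier K"
    using g \<phi> by (simp_all add: bij_betw_def)
  have \<psi>\<phi>: "\<psi> (\<phi> x) = x" if "x \<in> carrier K" for x
    unfolding \<psi>_def using bij_betw_inv_into_left[OF \<phi> that] .
  have fwd: "W.gen_set (g ` A)" if "A \<subseteq> carrier V" "V.gen_set A" for A
  proof (rule semilinear_image_gen_set[where \<phi> = \<phi> and g = g, OF V W _ _ _ _ that])
    show "\<phi> a \<in> carrier L" if "a \<in> carrier K" for a using that cL by simp
    show "g ` carrier V = carrier W" by (rule cW[symmetric])
  qed (simp_all only: add smult)
  have bwd: "V.gen_set (h ` A)" if "A \<subseteq> carrier W" "W.gen_set A" for A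
  proof (rule semilinear_image_gen_set[where \<phi> = \<psi> and g = h, OF W V _ _ _ _ that])
    show "h (x \<oplus>\<^bsub>W\<^esub> y) = h x \<oplus>\<^bsub>V\<^esub> h y" if "x \<in> carrier W" "y \<in> carrier W" for x y
      using that by (auto simp: cW add[symmetric] hg)
    show "h (a \<odot>\<^bsub>W\<^esub> x) = \<psi> a \<odot>\<^bsub>V\<^esub> h x" if "a \<in> carrier L" "x \<in> carrier W" for a x
      using that by (auto simp: cW cL smult[symmetric] hg \<psi>\<phi>)
    show "\<psi> a \<in> carrier K" if "a \<in> carrier L" for a using that \<psi> by (auto simp: bij_betw_def)
    show "h ` carrier W = carrier V" using h by (simp add: bij_betw_def)
  qed
  have "(\<exists>A. finite A \<and> card A = n \<and> A \<subseteq> carrier W \<and> W.gen_set A) \<longleftrightarrow>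
        (\<exists>A. finite A \<and> card A = n \<and> A \<subseteq> carrier V \<and> V.gen_set A)" for n
  proof
    assume "\<exists>A. finite A \<and> card A = n \<and> A \<subseteq> carrier W \<and> W.gen_set A"
    then obtain A where "finite A" "card A = n" "A \<subseteq> carrier W" "W.gen_set A" by blast
    moreover have "inj_on h A"
      by (rule inj_on_subset[OF bij_betw_imp_inj_on[OF h] \<open>A \<subseteq> carrier W\<close>])
    ultimately show "\<exists>A. finite A \<and> card A = n \<and> A \<subseteq> carrier V \<and> V.gen_set A"
      using bwd[of A] bij_betw_imp_surj_on[OF h] by (intro exI[of _ "h ` A"]) (metis card_image finite_imageI image_mono)
  next
    assume "\<exists>A. finite A \<and> card A = n \<and> A \<subseteq> carrier V \<and> V.gen_set A"
    then obtain A where "finite A" "card A = n" "A \<subseteq> carrier V" "V.gen_set A" by blast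
    moreover have "inj_on g A"
      by (rule inj_on_subset[OF bij_betw_imp_inj_on[OF g] \<open>A \<subseteq> carrier V\<close>])
    ultimately show "\<exists>A. finite A \<and> card A = n \<and> A \<subseteq> carrier W \<and> W.gen_set A"
      using fwd[of A] bij_betw_imp_surj_on[OF g] by (intro exI[of _ "g ` A"]) (metis card_image finite_imageI image_mono)
  qed
  then show ?thesis by (simp add: V.dim_def W.dim_def)
qed

text \<open>Rank-nullity. The kernel gets an explicit carrier so that it can be the target of the
  reduction of cycles modulo J.\<close>

lemma dim_surj_mat_kernel:
  fixes A :: "'f::field mat"
  assumes A: "A \<in> carrier_mat h n"
    and surj: "\<And>w. w \<in> carrier_vec h \<Longrightarrow> \<exists>v\<in>carrier_vec n. A *\<^sub>v v = w"
  defines "W \<equiv> (module_vec TYPE('f) n)\<lparr>carrier := {v \<in> carrier_vec n. A *\<^sub>v v = 0\<^sub>v h}\<rparr>"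
  shows "vectorspace class_ring W"
    and "vectorspace.dim class_ring W + h = n"
proof -
  interpret V: vec_space "TYPE('f)" n .
  interpret U: vec_space "TYPE('f)" h .
  interpret T: linear_map class_ring V.V U.V "\<lambda>v. A *\<^sub>v v"
    by unfold_locales
      (use A in \<open>auto simp: module_hom_def module_vec_simps mult_add_distrib_mat_vec mult_mat_vec\<close>)
  have ker: "T.kerT = {v \<in> carrier_vec n. A *\<^sub>v v = 0\<^sub>v h}"
    by (auto simp: T.ker_def module_vec_simps)
  have im: "T.imT = carrier_vec h"
    using A surj by (fastforce simp: T.im_def module_vec_simps)
  have W: "W = V.V\<lparr>carrier := T.kerT\<rparr>" unfolding W_def ker ..
  show "vectorspace class_ring W"
    unfolding W by (rule V.subspace_is_vs[OF T.kerT_is_subspace])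
  have U: "U.V\<lparr>carrier := carrier_vec h\<rparr> = U.V" by (simp add: module_vec_def)
  show "vectorspace.dim class_ring W + h = n"
    using T.rank_nullity U.dim_is_n V.dim_is_n unfolding im W U by simp
qed

section \<open>Localization at the zero ideal\<close>

text \<open>\<open>\<rho>\<close> embeds the domain \<open>R\<close> into its field of fractions, and \<open>\<mu>\<close> identifies the
  localization of \<open>M\<close> with the vector space \<open>W\<close>.\<close>

locale fraction_field_map =
  fixes R :: "'r ring" and \<rho> :: "'r \<Rightarrow> 'f::field"
  assumes R_closed: "\<zero>\<^bsub>R\<^esub> \<in> carrier R" "\<one>\<^bsub>R\<^esub> \<in> carrier R"
      "\<And>a b. a \<in> carrier R \<Longrightarrow> b \<in> carrier R \<Longrightarrow> a \<otimes>\<^bsub>R\<^esub> b \<in> carrier R"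
    and \<rho>_add: "\<And>a b. a \<in> carrier R \<Longrightarrow> b \<in> carrier R \<Longrightarrow> \<rho> (a \<oplus>\<^bsub>R\<^esub> b) = \<rho> a + \<rho> b"
    and \<rho>_mult: "\<And>a b. a \<in> carrier R \<Longrightarrow> b \<in> carrier R \<Longrightarrow> \<rho> (a \<otimes>\<^bsub>R\<^esub> b) = \<rho> a * \<rho> b"
    and \<rho>_zero: "\<rho> \<zero>\<^bsub>R\<^esub> = 0" and \<rho>_one: "\<rho> \<one>\<^bsub>R\<^esub> = 1"
    and \<rho>_inj: "inj_on \<rho> (carrier R)"
    and R_add_closed: "\<And>a b. a \<in> carrier R \<Longrightarrow> b \<in> carrier R \<Longrightarrow> a \<oplus>\<^bsub>R\<^esub> b \<in> carrier R"
    and \<rho>_frac: "\<And>x. \<exists>a\<in>carrier R. \<exists>s\<in>carrier R - {\<zero>\<^bsub>R\<^esub>}. \<rho> a = \<rho> s * x"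
begin

lemma \<rho>_nonzero: "s \<in> carrier R - {\<zero>\<^bsub>R\<^esub>} \<Longrightarrow> \<rho> s \<noteq> 0"
  using inj_onD[OF \<rho>_inj, of s "\<zero>\<^bsub>R\<^esub>"] R_closed(1) \<rho>_zero by auto

lemma nonzero_mult:
  "s \<in> carrier R - {\<zero>\<^bsub>R\<^esub>} \<Longrightarrow> t \<in> carrier R - {\<zero>\<^bsub>R\<^esub>} \<Longrightarrow> s \<otimes>\<^bsub>R\<^esub> t \<in> carrier R - {\<zero>\<^bsub>R\<^esub>}"
  using \<rho>_nonzero[of s] \<rho>_nonzero[of t] \<rho>_mult[of s t] R_closed(3)[of s t] \<rho>_zero by auto

lemma one_nonzero: "\<one>\<^bsub>R\<^esub> \<in> carrier R - {\<zero>\<^bsub>R\<^esub>}"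
  using R_closed(2) \<rho>_one \<rho>_zero by auto

end

locale generic_fibre = fraction_field_map R \<rho>
  for R :: "'r ring" and \<rho> :: "'r \<Rightarrow> 'f::field" +
  fixes M :: "('r, 'm) module" and \<mu> :: "'m \<Rightarrow> 'w" and W :: "('f, 'w) module"
  assumes W: "vectorspace class_ring W"
    and M_closed: "\<zero>\<^bsub>M\<^esub> \<in> carrier M"
      "\<And>x y. x \<in> carrier M \<Longrightarrow> y \<in> carrier M \<Longrightarrow> x \<oplus>\<^bsub>M\<^esub> y \<in> carrier M"
      "\<And>a x. a \<in> carrier R \<Longrightarrow> x \<in> carrier M \<Longrightarrow> a \<odot>\<^bsub>M\<^esub> x \<in> carrier M"
    and \<mu>_closed: "\<And>x. x \<in> carrier M \<Longrightarrow> \<mu> x \<in> carrier W"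
    and \<mu>_zero: "\<mu> \<zero>\<^bsub>M\<^esub> = \<zero>\<^bsub>W\<^esub>"
    and \<mu>_add: "\<And>x y. x \<in> carrier M \<Longrightarrow> y \<in> carrier M \<Longrightarrow> \<mu> (x \<oplus>\<^bsub>M\<^esub> y) = \<mu> x \<oplus>\<^bsub>W\<^esub> \<mu> y"
    and \<mu>_smult: "\<And>a x. a \<in> carrier R \<Longrightarrow> x \<in> carrier M \<Longrightarrow> \<mu> (a \<odot>\<^bsub>M\<^esub> x) = \<rho> a \<odot>\<^bsub>W\<^esub> \<mu> x"
    and \<mu>_inj: "\<And>x y. x \<in> carrier M \<Longrightarrow> y \<in> carrier M \<Longrightarrow> \<mu> x = \<mu> y \<Longrightarrow>
      \<exists>u\<in>carrier R - {\<zero>\<^bsub>R\<^esub>}. u \<odot>\<^bsub>M\<^esub> x = u \<odot>\<^bsub>M\<^esub> y"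
    and \<mu>_surj: "\<And>w. w \<in> carrier W \<Longrightarrow>
      \<exists>x\<in>carrier M. \<exists>s\<in>carrier R - {\<zero>\<^bsub>R\<^esub>}. \<mu> x = \<rho> s \<odot>\<^bsub>W\<^esub> w"
begin

sublocale W: vectorspace "class_ring :: 'f ring" W by (rule W)

lemma W_smult:
  "x \<in> carrier W \<Longrightarrow> a \<odot>\<^bsub>W\<^esub> x \<in> carrier W"
  "x \<in> carrier W \<Longrightarrow> y \<in> carrier W \<Longrightarrow> a \<odot>\<^bsub>W\<^esub> (x \<oplus>\<^bsub>W\<^esub> y) = a \<odot>\<^bsub>W\<^esub> x \<oplus>\<^bsub>W\<^esub> a \<odot>\<^bsub>W\<^esub> y"
  "x \<in> carrier W \<Longrightarrow> a \<odot>\<^bsub>W\<^esub> (b \<odot>\<^bsub>W\<^esub> x) = (a * b) \<odot>\<^bsub>W\<^esub> x"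
  "x \<in> carrier W \<Longrightarrow> 1 \<odot>\<^bsub>W\<^esub> x = x"
  using W.smult_closed[of a x] W.smult_r_distr[of a x y] W.smult_assoc1[of a b x] W.smult_one[of x]
  by simp_all

definition quot :: "'m \<times> 'r \<Rightarrow> 'w" where
  "quot p = inverse (\<rho> (snd p)) \<odot>\<^bsub>W\<^esub> \<mu> (fst p)"

text \<open>The set of all ways to write \<open>w\<close> as a fraction. These fibres turn out to be
  the classes of \<open>loc_rel\<close>, so the identification runs from \<open>W\<close> to the
  localization and needs no choice of representatives.\<close>

definition fib :: "'w \<Rightarrow> ('m \<times> 'r) set" where
  "fib w = {p \<in> carrier M \<times> (carrier R - {\<zero>\<^bsub>R\<^esub>}). quot p = w}"

lemma quot_eq_iff:
  assumes "x \<in> carrier M" "y \<in> carrier M"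
    and "s \<in> carrier R - {\<zero>\<^bsub>R\<^esub>}" "t \<in> carrier R - {\<zero>\<^bsub>R\<^esub>}"
  shows "quot (x, s) = quot (y, t) \<longleftrightarrow> \<rho> t \<odot>\<^bsub>W\<^esub> \<mu> x = \<rho> s \<odot>\<^bsub>W\<^esub> \<mu> y"
proof
  assume "quot (x, s) = quot (y, t)"
  then have "(\<rho> s * \<rho> t) \<odot>\<^bsub>W\<^esub> quot (x, s) = (\<rho> s * \<rho> t) \<odot>\<^bsub>W\<^esub> quot (y, t)" by simp
  then show "\<rho> t \<odot>\<^bsub>W\<^esub> \<mu> x = \<rho> s \<odot>\<^bsub>W\<^esub> \<mu> y"
    using assms \<rho>_nonzero[of s] \<rho>_nonzero[of t]
    by (simp add: quot_def W_smult \<mu>_closed field_simps)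
next
  assume "\<rho> t \<odot>\<^bsub>W\<^esub> \<mu> x = \<rho> s \<odot>\<^bsub>W\<^esub> \<mu> y"
  then have "inverse (\<rho> s * \<rho> t) \<odot>\<^bsub>W\<^esub> (\<rho> t \<odot>\<^bsub>W\<^esub> \<mu> x) = inverse (\<rho> s * \<rho> t) \<odot>\<^bsub>W\<^esub> (\<rho> s \<odot>\<^bsub>W\<^esub> \<mu> y)"
    by simp
  then have "(inverse (\<rho> s * \<rho> t) * \<rho> t) \<odot>\<^bsub>W\<^esub> \<mu> x = (inverse (\<rho> s * \<rho> t) * \<rho> s) \<odot>\<^bsub>W\<^esub> \<mu> y"
    using assms by (simp only: W_smult \<mu>_closed)
  moreover have "inverse (\<rho> s * \<rho> t) * \<rho> t = inverse (\<rho> s)" "inverse (\<rho> s * \<rho> t) * \<rho> s = inverse (\<rho> t)"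
    using assms \<rho>_nonzero[of s] \<rho>_nonzero[of t] by simp_all
  ultimately show "quot (x, s) = quot (y, t)" by (simp only: quot_def fst_conv snd_conv)
qed

text \<open>The factor \<open>u\<close> in \<open>loc_rel\<close> acts invertibly on
  \<open>W\<close> and can be cancelled there; conversely \<open>\<mu>_inj\<close> supplies such a
  factor. Being the kernel of the map \<open>quot\<close>, the relation needs no separate proof of
  transitivity.\<close>

lemma loc_rel_iff:
  "(p, q) \<in> loc_rel R {\<zero>\<^bsub>R\<^esub>} M \<longleftrightarrow>
     p \<in> carrier M \<times> (carrier R - {\<zero>\<^bsub>R\<^esub>}) \<and> q \<in> carrier M \<times> (carrier R - {\<zero>\<^bsub>R\<^esub>}) \<and> quot p = quot q"
proof (cases p; cases q)
  fix x s y t assume pq: "p = (x, s)" "q = (y, t)"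
  show ?thesis
  proof (cases "x \<in> carrier M \<and> y \<in> carrier M \<and>
      s \<in> carrier R - {\<zero>\<^bsub>R\<^esub>} \<and> t \<in> carrier R - {\<zero>\<^bsub>R\<^esub>}")
    case True
    then have mem: "t \<odot>\<^bsub>M\<^esub> x \<in> carrier M" "s \<odot>\<^bsub>M\<^esub> y \<in> carrier M"
      and \<mu>_eq: "\<mu> (t \<odot>\<^bsub>M\<^esub> x) = \<rho> t \<odot>\<^bsub>W\<^esub> \<mu> x" "\<mu> (s \<odot>\<^bsub>M\<^esub> y) = \<rho> s \<odot>\<^bsub>W\<^esub> \<mu> y"
      by (auto intro!: M_closed simp: \<mu>_smult)
    have "(\<exists>u\<in>carrier R - {\<zero>\<^bsub>R\<^esub>}. u \<odot>\<^bsub>M\<^esub> (t \<odot>\<^bsub>M\<^esub> x) = u \<odot>\<^bsub>M\<^esub> (s \<odot>\<^bsub>M\<^esub> y)) \<longleftrightarrow>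
        \<mu> (t \<odot>\<^bsub>M\<^esub> x) = \<mu> (s \<odot>\<^bsub>M\<^esub> y)"
    proof
      assume "\<exists>u\<in>carrier R - {\<zero>\<^bsub>R\<^esub>}. u \<odot>\<^bsub>M\<^esub> (t \<odot>\<^bsub>M\<^esub> x) = u \<odot>\<^bsub>M\<^esub> (s \<odot>\<^bsub>M\<^esub> y)"
      then obtain u where u: "u \<in> carrier R - {\<zero>\<^bsub>R\<^esub>}"
        and eq: "u \<odot>\<^bsub>M\<^esub> (t \<odot>\<^bsub>M\<^esub> x) = u \<odot>\<^bsub>M\<^esub> (s \<odot>\<^bsub>M\<^esub> y)" by blast
      from eq have "\<mu> (u \<odot>\<^bsub>M\<^esub> (t \<odot>\<^bsub>M\<^esub> x)) = \<mu> (u \<odot>\<^bsub>M\<^esub> (s \<odot>\<^bsub>M\<^esub> y))" by simp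
      then have "\<rho> u \<odot>\<^bsub>W\<^esub> \<mu> (t \<odot>\<^bsub>M\<^esub> x) = \<rho> u \<odot>\<^bsub>W\<^esub> \<mu> (s \<odot>\<^bsub>M\<^esub> y)"
        using u mem by (simp add: \<mu>_smult)
      then have "inverse (\<rho> u) \<odot>\<^bsub>W\<^esub> (\<rho> u \<odot>\<^bsub>W\<^esub> \<mu> (t \<odot>\<^bsub>M\<^esub> x)) =
          inverse (\<rho> u) \<odot>\<^bsub>W\<^esub> (\<rho> u \<odot>\<^bsub>W\<^esub> \<mu> (s \<odot>\<^bsub>M\<^esub> y))" by simp
      then show "\<mu> (t \<odot>\<^bsub>M\<^esub> x) = \<mu> (s \<odot>\<^bsub>M\<^esub> y)"
        using mem \<rho>_nonzero[OF u] by (simp add: W_smult \<mu>_closed)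
    next
      assume "\<mu> (t \<odot>\<^bsub>M\<^esub> x) = \<mu> (s \<odot>\<^bsub>M\<^esub> y)"
      then show "\<exists>u\<in>carrier R - {\<zero>\<^bsub>R\<^esub>}. u \<odot>\<^bsub>M\<^esub> (t \<odot>\<^bsub>M\<^esub> x) = u \<odot>\<^bsub>M\<^esub> (s \<odot>\<^bsub>M\<^esub> y)"
        using \<mu>_inj[OF mem] by blast
    qed
    then show ?thesis using True quot_eq_iff[of x y s t] by (simp add: pq loc_rel_def \<mu>_eq)
  next
    case False
    then show ?thesis by (auto simp: pq loc_rel_def)
  qed
qed

lemma loc_frac_eq:
  assumes "x \<in> carrier M" "s \<in> carrier R - {\<zero>\<^bsub>R\<^esub>}"
  shows "loc_frac R {\<zero>\<^bsub>R\<^esub>} M x s = fib (quot (x, s))"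
  using assms by (auto simp: loc_frac_def Image_def loc_rel_iff fib_def)

lemma quot_closed:
  "p \<in> carrier M \<times> (carrier R - {\<zero>\<^bsub>R\<^esub>}) \<Longrightarrow> quot p \<in> carrier W"
  by (auto simp: quot_def W_smult \<mu>_closed)

lemma fib_nonempty:
  assumes "w \<in> carrier W"
  shows "fib w \<noteq> {}"
proof -
  obtain x s where x: "x \<in> carrier M" and s: "s \<in> carrier R - {\<zero>\<^bsub>R\<^esub>}" and eq: "\<mu> x = \<rho> s \<odot>\<^bsub>W\<^esub> w"
    using \<mu>_surj[OF assms] by blast
  have "quot (x, s) = w" using \<rho>_nonzero[OF s] assms by (simp add: quot_def eq W_smult)
  then have "(x, s) \<in> fib w" using x s by (simp add: fib_def)
  then show ?thesis by blast
qed

text \<open>Operations on classes are unions over all representatives. Such a union of equal values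
  is that value because fibres are nonempty, which is where \<open>\<mu>_surj\<close>
  enters.\<close>

lemma UN_fib:
  assumes "w \<in> carrier W" "\<And>x s. (x, s) \<in> fib w \<Longrightarrow> F x s = c"
  shows "(\<Union>(x, s)\<in>fib w. F x s) = c"
  using fib_nonempty[OF assms(1)] assms(2) by auto

lemma fib_bij:
  "bij_betw fib (carrier W) ((carrier M \<times> (carrier R - {\<zero>\<^bsub>R\<^esub>})) // loc_rel R {\<zero>\<^bsub>R\<^esub>} M)"
proof (rule bij_betw_imageI)
  show "inj_on fib (carrier W)"
  proof (rule inj_onI)
    fix v w assume v: "v \<in> carrier W" and eq: "fib v = fib w"
    obtain p where "p \<in> fib v" using fib_nonempty[OF v] by blast
    moreover from this have "p \<in> fib w" unfolding eq .
    ultimately show "v = w" by (simp add: fib_def)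
  qed
  have cls: "loc_rel R {\<zero>\<^bsub>R\<^esub>} M `` {p} = fib (quot p)"
    if "p \<in> carrier M \<times> (carrier R - {\<zero>\<^bsub>R\<^esub>})" for p
    using that by (auto simp: Image_def loc_rel_iff fib_def)
  show "fib ` carrier W = (carrier M \<times> (carrier R - {\<zero>\<^bsub>R\<^esub>})) // loc_rel R {\<zero>\<^bsub>R\<^esub>} M" (is "_ = ?Q")
  proof
    show "fib ` carrier W \<subseteq> ?Q"
    proof
      fix c assume "c \<in> fib ` carrier W"
      then obtain w where w: "w \<in> carrier W" and c: "c = fib w" by blast
      obtain p where p: "p \<in> fib w" using fib_nonempty[OF w] by blast
      then have mem: "p \<in> carrier M \<times> (carrier R - {\<zero>\<^bsub>R\<^esub>})" and "quot p = w"
        by (simp_all add: fib_def)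
      with cls[OF mem] c have "c = loc_rel R {\<zero>\<^bsub>R\<^esub>} M `` {p}" by simp
      with mem show "c \<in> ?Q" by (simp add: quotientI)
    qed
    show "?Q \<subseteq> fib ` carrier W"
    proof
      fix c assume "c \<in> ?Q"
      then obtain p where p: "p \<in> carrier M \<times> (carrier R - {\<zero>\<^bsub>R\<^esub>})"
        and c: "c = loc_rel R {\<zero>\<^bsub>R\<^esub>} M `` {p}" by (rule quotientE)
      show "c \<in> fib ` carrier W" unfolding c cls[OF p] using quot_closed[OF p] by (rule imageI)
    qed
  qed
qed

lemma quot_add:
  assumes "(x, s) \<in> fib v" "(y, t) \<in> fib w"
  shows "loc_frac R {\<zero>\<^bsub>R\<^esub>} M (t \<odot>\<^bsub>M\<^esub> x \<oplus>\<^bsub>M\<^esub> s \<odot>\<^bsub>M\<^esub> y) (s \<otimes>\<^bsub>R\<^esub> t) = fib (v \<oplus>\<^bsub>W\<^esub> w)"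
proof -
  have mem: "x \<in> carrier M" "y \<in> carrier M" "s \<in> carrier R - {\<zero>\<^bsub>R\<^esub>}" "t \<in> carrier R - {\<zero>\<^bsub>R\<^esub>}"
    and v: "v = quot (x, s)" and w: "w = quot (y, t)"
    using assms by (auto simp: fib_def)
  have inv: "inverse (\<rho> s) * inverse (\<rho> t) * \<rho> t = inverse (\<rho> s)"
    "inverse (\<rho> s) * inverse (\<rho> t) * \<rho> s = inverse (\<rho> t)"
    using mem \<rho>_nonzero[of s] \<rho>_nonzero[of t] by simp_all
  have "quot (t \<odot>\<^bsub>M\<^esub> x \<oplus>\<^bsub>M\<^esub> s \<odot>\<^bsub>M\<^esub> y, s \<otimes>\<^bsub>R\<^esub> t) = v \<oplus>\<^bsub>W\<^esub> w"
    using mem by (simp add: v w quot_def \<rho>_mult \<mu>_add \<mu>_smult M_closed W_smult \<mu>_closed inv)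
  moreover have "t \<odot>\<^bsub>M\<^esub> x \<oplus>\<^bsub>M\<^esub> s \<odot>\<^bsub>M\<^esub> y \<in> carrier M"
    using mem by (intro M_closed) auto
  ultimately show ?thesis using loc_frac_eq[OF _ nonzero_mult[OF mem(3,4)]] by simp
qed

lemma fib_add:
  assumes "v \<in> carrier W" "w \<in> carrier W"
  shows "(\<Union>(x, s)\<in>fib v. \<Union>(y, t)\<in>fib w.
      loc_frac R {\<zero>\<^bsub>R\<^esub>} M (t \<odot>\<^bsub>M\<^esub> x \<oplus>\<^bsub>M\<^esub> s \<odot>\<^bsub>M\<^esub> y) (s \<otimes>\<^bsub>R\<^esub> t)) = fib (v \<oplus>\<^bsub>W\<^esub> w)"
  by (rule UN_fib[OF assms(1)], rule UN_fib[OF assms(2)], rule quot_add)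

end

section \<open>The localized ring as a special case of the localized module\<close>

lemma self_module_simps [simp]:
  "carrier (self_module R) = carrier R" "zero (self_module R) = zero R"
  "add (self_module R) = add R" "smult (self_module R) = mult R"
  by (simp_all add: self_module_def)

lemma self_module_vectorspace: "vectorspace class_ring (self_module (class_ring :: 'f::field ring))"
proof -
  have "abelian_group (self_module (class_ring :: 'f ring))"
  proof (rule abelian_groupI)
    fix x :: 'f
    show "\<exists>y\<in>carrier (self_module class_ring). y \<oplus>\<^bsub>self_module class_ring\<^esub> x = \<zero>\<^bsub>self_module class_ring\<^esub>"
      by (intro bexI[of _ "- x"]) auto
  qed (auto simp: algebra_simps)
  then have "module class_ring (self_module (class_ring :: 'f ring))"
    by (intro moduleI class_cring.is_cring) (auto simp: algebra_simps)
  then show ?thesis by (simp add: vectorspace_def class_field)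
qed

text \<open>Addition and the bijection for scalars now come from the module case; for the localized
  ring only products, zero and one remain to be computed.\<close>

sublocale fraction_field_map \<subseteq> ring: generic_fibre R \<rho> "self_module R" \<rho> "self_module class_ring"
proof (rule generic_fibre.intro[OF fraction_field_map_axioms generic_fibre_axioms.intro], goal_cases)
  case 1 show ?case by (rule self_module_vectorspace)
next
  case (9 x y)
  then have "x = y" using inj_onD[OF \<rho>_inj, of x y] by simp
  then show ?case using one_nonzero by blast
next
  case (10 w)
  then show ?case using \<rho>_frac[of w] by simp
qed (auto simp: R_closed R_add_closed \<rho>_zero \<rho>_add \<rho>_mult)

context generic_fibre
begin

lemma ring_fib_mult: "ring.fib a \<otimes>\<^bsub>loc_ring R {\<zero>\<^bsub>R\<^esub>}\<^esub> ring.fib b = ring.fib (a * b)"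
proof -
  have "loc_frac R {\<zero>\<^bsub>R\<^esub>} (self_module R) (x \<otimes>\<^bsub>R\<^esub> y) (s \<otimes>\<^bsub>R\<^esub> t) = ring.fib (a * b)"
    if "(x, s) \<in> ring.fib a" "(y, t) \<in> ring.fib b" for x s y t
  proof -
    have mem: "x \<in> carrier R" "y \<in> carrier R" "s \<in> carrier R - {\<zero>\<^bsub>R\<^esub>}" "t \<in> carrier R - {\<zero>\<^bsub>R\<^esub>}"
      and v: "a = inverse (\<rho> s) * \<rho> x" "b = inverse (\<rho> t) * \<rho> y"
      using that by (auto simp: ring.fib_def ring.quot_def)
    have "ring.quot (x \<otimes>\<^bsub>R\<^esub> y, s \<otimes>\<^bsub>R\<^esub> t) = a * b"
      using mem by (simp add: ring.quot_def v \<rho>_mult)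
    then show ?thesis
      using ring.loc_frac_eq[of "x \<otimes>\<^bsub>R\<^esub> y" "s \<otimes>\<^bsub>R\<^esub> t"] nonzero_mult[OF mem(3,4)] R_closed(3)[OF mem(1,2)]
      by simp
  qed
  then have "(\<Union>(x, s)\<in>ring.fib a. \<Union>(y, t)\<in>ring.fib b.
      loc_frac R {\<zero>\<^bsub>R\<^esub>} (self_module R) (x \<otimes>\<^bsub>R\<^esub> y) (s \<otimes>\<^bsub>R\<^esub> t)) = ring.fib (a * b)"
    by (intro ring.UN_fib) auto
  then show ?thesis by (simp add: loc_ring_def)
qed

lemma fib_smult:
  assumes "w \<in> carrier W"
  shows "ring.fib a \<odot>\<^bsub>loc_module R {\<zero>\<^bsub>R\<^esub>} M\<^esub> fib w = fib (a \<odot>\<^bsub>W\<^esub> w)"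
proof -
  have "loc_frac R {\<zero>\<^bsub>R\<^esub>} M (x \<odot>\<^bsub>M\<^esub> y) (s \<otimes>\<^bsub>R\<^esub> t) = fib (a \<odot>\<^bsub>W\<^esub> w)"
    if "(x, s) \<in> ring.fib a" "(y, t) \<in> fib w" for x s y t
  proof -
    have mem: "x \<in> carrier R" "y \<in> carrier M" "s \<in> carrier R - {\<zero>\<^bsub>R\<^esub>}" "t \<in> carrier R - {\<zero>\<^bsub>R\<^esub>}"
      and v: "a = inverse (\<rho> s) * \<rho> x" "w = quot (y, t)"
      using that by (auto simp: ring.fib_def fib_def ring.quot_def)
    have "quot (x \<odot>\<^bsub>M\<^esub> y, s \<otimes>\<^bsub>R\<^esub> t) = a \<odot>\<^bsub>W\<^esub> w"
      using mem by (simp add: quot_def v \<rho>_mult \<mu>_smult W_smult \<mu>_closed mult_ac)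
    then show ?thesis
      using loc_frac_eq[of "x \<odot>\<^bsub>M\<^esub> y" "s \<otimes>\<^bsub>R\<^esub> t"] nonzero_mult[OF mem(3,4)] M_closed(3)[OF mem(1,2)]
      by simp
  qed
  then have "(\<Union>(x, s)\<in>ring.fib a. \<Union>(y, t)\<in>fib w.
      loc_frac R {\<zero>\<^bsub>R\<^esub>} M (x \<odot>\<^bsub>M\<^esub> y) (s \<otimes>\<^bsub>R\<^esub> t)) = fib (a \<odot>\<^bsub>W\<^esub> w)"
    by (intro ring.UN_fib UN_fib assms) auto
  then show ?thesis by (simp add: loc_module_def)
qed

lemma ring_fib_add: "ring.fib a \<oplus>\<^bsub>loc_ring R {\<zero>\<^bsub>R\<^esub>}\<^esub> ring.fib b = ring.fib (a + b)"
  using ring.fib_add[of a b] by (simp add: loc_ring_def)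

lemma ring_fib_zero: "\<zero>\<^bsub>loc_ring R {\<zero>\<^bsub>R\<^esub>}\<^esub> = ring.fib 0"
  and ring_fib_one: "\<one>\<^bsub>loc_ring R {\<zero>\<^bsub>R\<^esub>}\<^esub> = ring.fib 1"
  using ring.loc_frac_eq[of "\<zero>\<^bsub>R\<^esub>" "\<one>\<^bsub>R\<^esub>"] ring.loc_frac_eq[of "\<one>\<^bsub>R\<^esub>" "\<one>\<^bsub>R\<^esub>"] R_closed one_nonzero
  by (simp_all add: loc_ring_def ring.quot_def \<rho>_zero \<rho>_one)

lemma ring_fib_bij: "bij_betw ring.fib UNIV (carrier (loc_ring R {\<zero>\<^bsub>R\<^esub>}))"
  using ring.fib_bij by (simp add: loc_ring_def)

text \<open>The records \<open>loc_ring\<close> and \<open>loc_module\<close> come without any laws.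
  They inherit those of \<open>'f\<close> and \<open>W\<close> through \<open>ring.fib\<close> and
  \<open>fib\<close>; then \<open>fib\<close> is semilinear along \<open>ring.fib\<close> and
  preserves the dimension.\<close>

lemma module_rank_eq_dim: "module_rank R M = vectorspace.dim class_ring W"
proof -
  let ?K = "loc_ring R {\<zero>\<^bsub>R\<^esub>}" and ?V = "loc_module R {\<zero>\<^bsub>R\<^esub>} M"
  have K: "field ?K"
    by (rule field_bij_image[OF ring_fib_bij ring_fib_add ring_fib_mult ring_fib_zero ring_fib_one])
  have add: "fib x \<oplus>\<^bsub>?V\<^esub> fib y = fib (x \<oplus>\<^bsub>W\<^esub> y)" if "x \<in> carrier W" "y \<in> carrier W" for x y
    using fib_add[OF that] by (simp add: loc_module_def)
  have bij: "bij_betw fib (carrier W) (carrier ?V)"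
    using fib_bij by (simp add: loc_module_def)
  have zero: "\<zero>\<^bsub>?V\<^esub> = fib \<zero>\<^bsub>W\<^esub>"
    using loc_frac_eq[OF M_closed(1) one_nonzero]
    by (simp add: loc_module_def quot_def \<mu>_zero \<rho>_one W_smult)
  have V: "vectorspace ?K ?V"
    by (rule vectorspace_bij_image[OF K ring_fib_bij ring_fib_add ring_fib_mult ring_fib_one W bij
          add fib_smult zero])
  show ?thesis
    unfolding module_rank_def
    by (rule semilinear_bij_dim[where \<phi> = ring.fib and g = fib, OF W V])
      (simp_all add: ring_fib_bij bij add fib_smult)
qed

end

section \<open>First syzygies at the generic point\<close>

text \<open>Coordinate form of a Koszul chain of degree two. The zero diagonal is a separate
  condition because skew symmetry does not imply it in characteristic two.\<close>

definition alternating :: "(nat \<Rightarrow> nat \<Rightarrow> 's::ring_1) \<Rightarrow> bool" where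
  "alternating b \<longleftrightarrow> (\<forall>i. b i i = 0) \<and> (\<forall>i j. b i j = - b j i)"

lemma alternatingI:
  assumes "\<And>i. b i i = 0" "\<And>i j. b i j = - b j i"
  shows "alternating b"
  unfolding alternating_def using assms by blast

lemma alternatingD:
  assumes "alternating b"
  shows "b i i = 0" "b i j = - b j i"
  using assms unfolding alternating_def by blast+

text \<open>The kernel of \<pi> is the prime J, and \<open>frac\<close> makes \<open>'f\<close> the
  fraction field of S/J. The condition \<open>\<pi> u \<noteq> 0\<close> says that \<open>u\<close>
  becomes a unit in the local ring at J.\<close>

locale generic_point =
  fixes \<pi> :: "'s::comm_ring_1 \<Rightarrow> 'f::field"
  assumes add: "\<pi> (x + y) = \<pi> x + \<pi> y" and mult: "\<pi> (x * y) = \<pi> x * \<pi> y" and one: "\<pi> 1 = 1"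
    and frac: "\<exists>a s. \<pi> s \<noteq> 0 \<and> \<pi> a = \<pi> s * w"
begin

lemma zero: "\<pi> 0 = 0"
  using add[of 0 0] by (metis add.right_neutral add_left_cancel)

lemma uminus: "\<pi> (- x) = - \<pi> x"
  using add[of x "- x"] zero by (simp add: eq_neg_iff_add_eq_0 add.commute)

lemma diff: "\<pi> (x - y) = \<pi> x - \<pi> y"
  using add[of x "- y"] uminus by simp

lemma sum: "\<pi> (sum F A) = (\<Sum>i\<in>A. \<pi> (F i))"
  by (induction A rule: infinite_finite_induct) (simp_all add: zero add)

lemma prod: "\<pi> (prod F A) = (\<Prod>i\<in>A. \<pi> (F i))"
  by (induction A rule: infinite_finite_induct) (simp_all add: one mult)

lemmas hom_simps = zero one uminus add diff mult sum

lemma common_multiple: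
  assumes "\<And>i. i < n \<Longrightarrow> \<pi> (u i) \<noteq> 0"
  obtains s c where "\<pi> s \<noteq> 0" and "\<And>i. i < (n::nat) \<Longrightarrow> s = c i * u i"
proof
  show "\<pi> (\<Prod>j<n. u j) \<noteq> 0" using assms by (simp add: prod)
  show "(\<Prod>j<n. u j) = (\<Prod>j\<in>{..<n} - {i}. u j) * u i" if "i < n" for i
    using that by (simp add: prod.remove[of "{..<n}" i u] mult.commute)
qed

text \<open>Vanishing of the first Koszul homology of \<open>g 0, ..., g (h - 1)\<close> after
  localization at J, with the denominator \<open>u\<close> cleared.\<close>

definition generically_exact :: "nat \<Rightarrow> (nat \<Rightarrow> 's) \<Rightarrow> bool" where
  "generically_exact h g \<longleftrightarrow> (\<forall>q. (\<Sum>k<h. q k * g k) = 0 \<longrightarrow>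
     (\<exists>u b. \<pi> u \<noteq> 0 \<and> alternating b \<and> (\<forall>k<h. u * q k = (\<Sum>j<h. b k j * g j))))"

end

text \<open>Two generating systems of J: \<open>f\<close> over S itself and \<open>g\<close> only at
  the generic point. One denominator \<open>s\<close> serves all \<open>f i\<close>, and the matrix
  \<open>m\<close> over \<open>s\<close> expresses \<open>f\<close> through
  \<open>g\<close>.\<close>

locale generic_presentation = generic_point \<pi> for \<pi> :: "'s::comm_ring_1 \<Rightarrow> 'f::field" +
  fixes n h :: nat and f g :: "nat \<Rightarrow> 's" and s :: 's and m :: "nat \<Rightarrow> nat \<Rightarrow> 's"
  assumes f_mem: "i < n \<Longrightarrow> \<pi> (f i) = 0"
    and f_gen: "\<pi> x = 0 \<Longrightarrow> \<exists>w. x = (\<Sum>i<n. w i * f i)"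
    and g_mem: "k < h \<Longrightarrow> \<pi> (g k) = 0"
    and exact: "generically_exact h g"
    and s_nonzero: "\<pi> s \<noteq> 0"
    and s_f: "i < n \<Longrightarrow> s * f i = (\<Sum>k<h. m i k * g k)"
begin

definition coef :: "nat \<Rightarrow> nat \<Rightarrow> 's" where
  "coef k = (SOME w. g k = (\<Sum>i<n. w i * f i))"

lemma g_eq: "k < h \<Longrightarrow> g k = (\<Sum>i<n. coef k i * f i)"
  unfolding coef_def by (rule someI_ex[OF f_gen[OF g_mem]])

text \<open>Koszul syzygies have coefficients in the ideal of the \<open>g k\<close>, hence in J,
  and the multiplier cancels in the field. In other words, the \<open>g k\<close> are independent in
  J/J^2 at the generic point.\<close>

lemma syzygy_vanishes:
  assumes "(\<Sum>k<h. q k * g k) = 0" "k < h"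
  shows "\<pi> (q k) = 0"
proof -
  obtain u b where u: "\<pi> u \<noteq> 0" and eq: "\<forall>k<h. u * q k = (\<Sum>j<h. b k j * g j)"
    using exact assms(1) unfolding generically_exact_def by blast
  have "\<pi> (u * q k) = 0" using eq assms(2) by (simp add: hom_simps g_mem)
  then show ?thesis using u by (simp add: mult)
qed

lemma sum_s_f: "(\<Sum>k<h. (\<Sum>i<n. z i * m i k) * g k) = s * (\<Sum>i<n. z i * f i)"
proof -
  have "(\<Sum>k<h. (\<Sum>i<n. z i * m i k) * g k) = (\<Sum>i<n. z i * (\<Sum>k<h. m i k * g k))"
    by (simp add: sum_distrib_left sum_distrib_right mult.assoc sum.swap[of _ "{..<n}"])
  also have "\<dots> = s * (\<Sum>i<n. z i * f i)"
    by (simp add: s_f[symmetric] sum_distrib_left mult.left_commute)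
  finally show ?thesis .
qed

text \<open>Applying \<open>m\<close> to a cycle of \<open>f\<close> gives a syzygy of
  \<open>g\<close>, which reduces to zero modulo J.\<close>

lemma cycle_relation:
  assumes "(\<Sum>i<n. z i * f i) = 0" "k < h"
  shows "(\<Sum>i<n. \<pi> (m i k) * \<pi> (z i)) = 0"
proof -
  have "\<pi> (\<Sum>i<n. z i * m i k) = 0"
    by (rule syzygy_vanishes[OF _ assms(2)]) (simp add: sum_s_f assms(1))
  then show ?thesis by (simp add: hom_simps mult.commute)
qed

text \<open>Clearing denominators turns the relation \<open>w\<close> into a vector \<open>y\<close>
  over S that need not be a cycle. Its defect \<open>p\<close> has entries in J, so it can be
  corrected without changing the reduction modulo J beyond a unit.\<close>

lemma relation_lift:
  assumes w: "\<And>k. k < h \<Longrightarrow> (\<Sum>i<n. \<pi> (m i k) * w i) = 0"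
  shows "\<exists>z t. \<pi> t \<noteq> 0 \<and> (\<Sum>i<n. z i * f i) = 0 \<and> (\<forall>i<n. \<pi> (z i) = \<pi> t * w i)"
proof -
  have "\<forall>i. \<exists>a d. \<pi> d \<noteq> 0 \<and> \<pi> a = \<pi> d * w i" using frac by blast
  then obtain a d where d: "\<And>i. \<pi> (d i) \<noteq> 0" and a: "\<And>i. \<pi> (a i) = \<pi> (d i) * w i" by metis
  obtain t e where t: "\<pi> t \<noteq> 0" and e: "\<And>i. i < n \<Longrightarrow> t = e i * d i"
    using common_multiple[of n d] d by blast
  define y where "y i = e i * a i" for i
  have y: "\<pi> (y i) = \<pi> t * w i" if "i < n" for i
    using e[OF that] by (simp add: y_def mult a mult.assoc)
  define p where "p k = (\<Sum>i<n. y i * m i k)" for k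
  have p: "\<pi> (p k) = 0" if "k < h" for k
  proof -
    have "\<pi> (p k) = \<pi> t * (\<Sum>i<n. \<pi> (m i k) * w i)"
      by (simp add: p_def hom_simps y sum_distrib_left mult_ac)
    then show ?thesis using w[OF that] by simp
  qed
  \<comment> \<open>By \<open>sum_s_f\<close> the value of \<open>s * y\<close> on \<open>f\<close>
    is \<open>\<Sum>k<h. p k * g k\<close>; subtracting the lifts of the \<open>g k\<close> with
    coefficients \<open>p k\<close> cancels it exactly.\<close>
  define z where "z i = s * y i - (\<Sum>k<h. p k * coef k i)" for i
  have "(\<Sum>i<n. z i * f i) = s * (\<Sum>i<n. y i * f i) - (\<Sum>i<n. \<Sum>k<h. p k * coef k i * f i)"
    by (simp add: z_def left_diff_distrib sum_subtractf sum_distrib_left sum_distrib_right mult.assoc)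
  also have "(\<Sum>i<n. \<Sum>k<h. p k * coef k i * f i) = (\<Sum>k<h. p k * g k)"
    by (subst sum.swap) (simp add: g_eq sum_distrib_left mult.assoc)
  also have "\<dots> = s * (\<Sum>i<n. y i * f i)" unfolding p_def by (rule sum_s_f)
  finally have "(\<Sum>i<n. z i * f i) = 0" by simp
  moreover have "\<pi> (z i) = \<pi> (s * t) * w i" if "i < n" for i
    using that by (simp add: z_def hom_simps p y)
  moreover have "\<pi> (s * t) \<noteq> 0" using s_nonzero t by (simp add: mult)
  ultimately show ?thesis by blast
qed

text \<open>The matrix \<open>coef\<close> is a right inverse up to the unit \<open>\<pi> s\<close>:
  expressing \<open>s * g j\<close> through \<open>f\<close> and back through \<open>g\<close>
  differs from \<open>s * g j\<close> by a syzygy of \<open>g\<close>, whose coefficients vanish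
  modulo J.\<close>

lemma m_surj: "\<exists>v. \<forall>k<h. (\<Sum>i<n. \<pi> (m i k) * v i) = w k"
proof -
  have cm: "(\<Sum>i<n. \<pi> (coef j i) * \<pi> (m i k)) = (if k = j then \<pi> s else 0)"
    if "j < h" "k < h" for j k
  proof -
    let ?q = "\<lambda>k. (\<Sum>i<n. coef j i * m i k) - (if k = j then s else 0)"
    have "(\<Sum>k<h. (if k = j then s else 0) * g k) = (\<Sum>k<h. if k = j then s * g k else 0)"
      by (rule sum.cong) auto
    also have "\<dots> = s * g j" using that(1) by simp
    finally have "(\<Sum>k<h. ?q k * g k) = s * (\<Sum>i<n. coef j i * f i) - s * g j"
      by (simp add: left_diff_distrib sum_subtractf sum_s_f)
    then have "(\<Sum>k<h. ?q k * g k) = 0" using g_eq[OF that(1)] by simp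
    from syzygy_vanishes[OF this that(2)] show ?thesis
      by (cases "k = j") (simp_all add: hom_simps)
  qed
  define v where "v i = (\<Sum>j<h. w j * \<pi> (coef j i) / \<pi> s)" for i
  have "(\<Sum>i<n. \<pi> (m i k) * v i) = w k" if "k < h" for k
  proof -
    have "(\<Sum>i<n. \<pi> (m i k) * v i) =
        (\<Sum>j<h. w j / \<pi> s * (\<Sum>i<n. \<pi> (coef j i) * \<pi> (m i k)))"
      by (simp add: v_def sum_distrib_left sum.swap[of _ "{..<n}"] mult_ac)
    also have "\<dots> = (\<Sum>j<h. if j = k then w k else 0)"
      using that s_nonzero by (intro sum.cong) (auto simp: cm)
    also have "\<dots> = w k" using that by simp
    finally show ?thesis .
  qed
  then show ?thesis by (intro exI[of _ v]) simp
qed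

text \<open>The cycles \<open>\<zeta> i\<close> express \<open>s e\<^sub>i\<close> modulo cycles through the lifts \<open>E\<^sub>k = \<Sum>i. coef k i e\<^sub>i\<close> of the
  \<open>g k\<close>. As \<open>J Z\<^sub>1 \<subseteq> B\<^sub>1\<close> for \<open>J\<close> the kernel of \<open>\<pi>\<close>, a cycle with coefficients in \<open>J\<close> is, up to boundaries
  and the factor \<open>s\<close>, a combination of the \<open>E\<^sub>k\<close> by a syzygy of the \<open>g k\<close>, which is a Koszul
  syzygy.\<close>

lemma cycle_in_kernel_boundary:
  assumes z: "(\<Sum>i<n. z i * f i) = 0" and \<pi>z: "\<And>i. i < n \<Longrightarrow> \<pi> (z i) = 0"
  shows "\<exists>u b. \<pi> u \<noteq> 0 \<and> alternating b \<and> (\<forall>i<n. u * z i = (\<Sum>j<n. b i j * f j))"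
proof -
  have "\<forall>i. \<exists>w. i < n \<longrightarrow> z i = (\<Sum>l<n. w l * f l)" using f_gen[OF \<pi>z] by blast
  then obtain w where w: "\<And>i. i < n \<Longrightarrow> z i = (\<Sum>l<n. w i l * f l)" by metis
  define q where "q k = (\<Sum>i<n. z i * m i k)" for k
  have "(\<Sum>k<h. q k * g k) = 0" unfolding q_def sum_s_f z by simp
  then obtain u \<beta> where u: "\<pi> u \<noteq> 0" and \<beta>: "alternating \<beta>"
    and uq: "\<And>k. k < h \<Longrightarrow> u * q k = (\<Sum>l<h. \<beta> k l * g l)"
    using exact unfolding generically_exact_def by blast
  define \<zeta> where "\<zeta> i t = (if i = t then s else 0) - (\<Sum>k<h. m i k * coef k t)" for i t
  have \<zeta>_cycle: "(\<Sum>t<n. \<zeta> i t * f t) = 0" if "i < n" for i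
  proof -
    have "(\<Sum>t<n. (if i = t then s else 0) * f t) = (\<Sum>t<n. if i = t then s * f t else 0)"
      by (rule sum.cong) auto
    also have "\<dots> = s * f i" using that by simp
    finally have "(\<Sum>t<n. \<zeta> i t * f t) = s * f i - (\<Sum>k<h. m i k * (\<Sum>t<n. coef k t * f t))"
      by (simp add: \<zeta>_def left_diff_distrib sum_subtractf sum_distrib_left sum_distrib_right
          mult.assoc sum.swap[of _ "{..<n}"])
    then show ?thesis using s_f[OF that] by (simp add: g_eq[symmetric])
  qed
  have sz: "s * z t = (\<Sum>i<n. z i * \<zeta> i t) + (\<Sum>k<h. q k * coef k t)" if "t < n" for t
  proof -
    have "(\<Sum>i<n. z i * (if i = t then s else 0)) = (\<Sum>i<n. if i = t then z i * s else 0)"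
      by (rule sum.cong) auto
    also have "\<dots> = s * z t" using that by simp
    finally have "(\<Sum>i<n. z i * \<zeta> i t) = s * z t - (\<Sum>i<n. \<Sum>k<h. z i * m i k * coef k t)"
      by (simp add: \<zeta>_def right_diff_distrib sum_subtractf sum_distrib_left mult.assoc)
    moreover have "(\<Sum>i<n. \<Sum>k<h. z i * m i k * coef k t) = (\<Sum>k<h. q k * coef k t)"
      by (subst sum.swap) (simp add: q_def sum_distrib_right)
    ultimately show ?thesis by simp
  qed
  \<comment> \<open>The first sum bounds the combination of the cycles \<open>\<zeta> i\<close> with
    coefficients \<open>z i\<close> in J, written through \<open>w\<close>. The second transports
    the alternating matrix \<open>\<beta>\<close> from the \<open>g k\<close> to the
    \<open>f j\<close> by congruence with \<open>coef\<close>.\<close>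
  define b where "b t j = u * (\<Sum>i<n. w i j * \<zeta> i t - w i t * \<zeta> i j) +
    (\<Sum>k<h. \<Sum>l<h. coef k t * \<beta> k l * coef l j)" for t j
  have \<beta>_swap: "(\<Sum>k<h. \<Sum>l<h. coef k t * \<beta> k l * coef l j) = - (\<Sum>k<h. \<Sum>l<h. coef k j * \<beta> k l * coef l t)"
    for t j
  proof -
    have "(\<Sum>k<h. \<Sum>l<h. coef k t * \<beta> k l * coef l j) = (\<Sum>l<h. \<Sum>k<h. - (coef l j * \<beta> l k * coef k t))"
    proof (subst sum.swap, intro sum.cong refl)
      fix k l
      have "\<beta> k l = - \<beta> l k" by (rule alternatingD(2)[OF \<beta>])
      then show "coef k t * \<beta> k l * coef l j = - (coef l j * \<beta> l k * coef k t)" by (simp add: mult_ac)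
    qed
    then show ?thesis by (simp add: sum_negf)
  qed
  \<comment> \<open>\<open>\<beta>_swap\<close> would only give that twice this sum is zero.
    Induction on the size of the square cancels the entries (k, l) and (l, k) against each other
    without dividing by two.\<close>
  have \<beta>_diag: "(\<Sum>k<h. \<Sum>l<h. coef k t * \<beta> k l * coef l t) = 0" for t
  proof -
    have "(\<Sum>k<H. \<Sum>l<H. coef k t * \<beta> k l * coef l t) = 0" for H
    proof (induction H)
      case (Suc H)
      have "(\<Sum>l<H. coef H t * \<beta> H l * coef l t) = (\<Sum>l<H. - (coef l t * \<beta> l H * coef H t))"
      proof (rule sum.cong[OF refl])
        fix l
        have "\<beta> H l = - \<beta> l H" by (rule alternatingD(2)[OF \<beta>])
        then show "coef H t * \<beta> H l * coef l t = - (coef l t * \<beta> l H * coef H t)" by (simp add: mult_ac)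
      qed
      moreover have "\<beta> H H = 0" by (rule alternatingD(1)[OF \<beta>])
      ultimately show ?case using Suc by (simp add: sum.distrib sum_negf)
    qed simp
    then show ?thesis .
  qed
  have "alternating b"
  proof (rule alternatingI)
    show "b i i = 0" for i by (simp add: b_def \<beta>_diag)
    show "b i j = - b j i" for i j
      unfolding b_def \<beta>_swap[of i j] by (simp add: sum_subtractf right_diff_distrib)
  qed
  moreover have "u * s * z t = (\<Sum>j<n. b t j * f j)" if "t < n" for t
  proof -
    have "(\<Sum>j<n. (\<Sum>i<n. w i j * \<zeta> i t - w i t * \<zeta> i j) * f j) =
        (\<Sum>j<n. \<Sum>i<n. \<zeta> i t * (w i j * f j) - w i t * (\<zeta> i j * f j))"
      by (simp add: sum_distrib_left sum_distrib_right left_diff_distrib right_diff_distrib mult_ac)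
    also have "\<dots> = (\<Sum>i<n. \<Sum>j<n. \<zeta> i t * (w i j * f j) - w i t * (\<zeta> i j * f j))"
      by (rule sum.swap)
    also have "\<dots> = (\<Sum>i<n. \<zeta> i t * (\<Sum>j<n. w i j * f j) - w i t * (\<Sum>j<n. \<zeta> i j * f j))"
      by (simp only: sum_subtractf sum_distrib_left)
    also have "\<dots> = (\<Sum>i<n. z i * \<zeta> i t)"
      by (rule sum.cong) (simp_all add: \<zeta>_cycle w[symmetric])
    finally have 1: "(\<Sum>j<n. (\<Sum>i<n. w i j * \<zeta> i t - w i t * \<zeta> i j) * f j) = (\<Sum>i<n. z i * \<zeta> i t)" .
    have "(\<Sum>j<n. (\<Sum>k<h. \<Sum>l<h. coef k t * \<beta> k l * coef l j) * f j) =
        (\<Sum>j<n. \<Sum>k<h. \<Sum>l<h. coef k t * (\<beta> k l * (coef l j * f j)))"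
      by (simp only: sum_distrib_right mult.assoc)
    also have "\<dots> = (\<Sum>k<h. \<Sum>j<n. \<Sum>l<h. coef k t * (\<beta> k l * (coef l j * f j)))"
      by (rule sum.swap)
    also have "\<dots> = (\<Sum>k<h. \<Sum>l<h. \<Sum>j<n. coef k t * (\<beta> k l * (coef l j * f j)))"
      by (intro sum.cong refl sum.swap)
    also have "\<dots> = (\<Sum>k<h. coef k t * (u * q k))"
      by (simp add: uq g_eq sum_distrib_left)
    also have "\<dots> = u * (\<Sum>k<h. q k * coef k t)" by (simp add: sum_distrib_left mult_ac)
    finally have 2: "(\<Sum>j<n. (\<Sum>k<h. \<Sum>l<h. coef k t * \<beta> k l * coef l j) * f j) = u * (\<Sum>k<h. q k * coef k t)" .
    have split: "(\<Sum>j<n. (u * X j + Y j) * f j) = u * (\<Sum>j<n. X j * f j) + (\<Sum>j<n. Y j * f j)"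
      for X Y by (simp add: distrib_right sum.distrib sum_distrib_left mult.assoc)
    show ?thesis
      unfolding b_def split 1 2 distrib_left[symmetric] sz[OF that, symmetric] by (rule mult.assoc)
  qed
  moreover have "\<pi> (u * s) \<noteq> 0" using u s_nonzero by (simp add: mult)
  ultimately show ?thesis by blast
qed

end

section \<open>Koszul homology in degree one\<close>


lemma koszul_chains_1:
  "z \<in> koszul_chains fs (Suc 0) \<longleftrightarrow> (\<forall>U. z U \<noteq> 0 \<longrightarrow> (\<exists>i<length fs. U = {i}))"
  by (auto simp: koszul_chains_def card_1_singleton_iff)

lemma koszul_cycles_1:
  "z \<in> carrier (koszul_cycles fs (Suc 0)) \<longleftrightarrow>
     z \<in> koszul_chains fs (Suc 0) \<and> (\<Sum>i<length fs. z {i} * fs ! i) = 0"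
proof -
  have diff: "koszul_diff fs z U = (if U = {} then (\<Sum>i<length fs. z {i} * fs ! i) else 0)"
    if z: "z \<in> koszul_chains fs (Suc 0)" for U
  proof (cases "U = {}")
    case True
    then show ?thesis by (simp add: koszul_diff_def mult.commute)
  next
    case False
    have "z (insert i U) = 0" if "i \<notin> U" for i
    proof (rule ccontr)
      assume "z (insert i U) \<noteq> 0"
      then obtain k where "insert i U = {k}" using z unfolding koszul_chains_1 by blast
      with False that show False by auto
    qed
    then show ?thesis using False by (simp add: koszul_diff_def)
  qed
  have "koszul_diff fs z = (\<lambda>_. 0) \<longleftrightarrow> (\<Sum>i<length fs. z {i} * fs ! i) = 0"
    if "z \<in> koszul_chains fs (Suc 0)" unfolding fun_eq_iff diff[OF that] by auto
  then show ?thesis by (auto simp: koszul_cycles_def)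
qed

text \<open>A chain indexed by unordered pairs becomes a matrix with signs: deleting the larger
  element of a pair contributes -1, deleting the smaller one +1.\<close>

lemma koszul_diff_2_singleton:
  assumes "k < length fs"
  shows "koszul_diff fs w {k} =
    (\<Sum>j<length fs. (if k < j then - w {k, j} else if j < k then w {k, j} else 0) * fs ! j)"
proof -
  have "koszul_diff fs w {k} = (\<Sum>j\<in>{..<length fs} - {k}.
      (if k < j then - w {k, j} else if j < k then w {k, j} else 0) * fs ! j)"
    unfolding koszul_diff_def
  proof (rule sum.cong[OF refl])
    fix j assume "j \<in> {..<length fs} - {k}"
    then have "j \<noteq> k" by simp
    moreover have "{i \<in> {k}. i < j} = (if k < j then {k} else {})" by auto
    ultimately show "(- 1) ^ card {i \<in> {k}. i < j} * fs ! j * w (insert j {k}) =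
        (if k < j then - w {k, j} else if j < k then w {k, j} else 0) * fs ! j"
      by (auto simp: insert_commute mult.commute)
  qed
  also have "\<dots> = (\<Sum>j<length fs. (if k < j then - w {k, j} else if j < k then w {k, j} else 0) * fs ! j)"
    using assms by (simp add: sum.remove[of "{..<length fs}" k])
  finally show ?thesis .
qed

lemma koszul_diff_2_chain:
  assumes "w \<in> koszul_chains fs 2"
  shows "koszul_diff fs w \<in> koszul_chains fs (Suc 0)"
  unfolding koszul_chains_1
proof (intro allI impI)
  fix U assume "koszul_diff fs w U \<noteq> 0"
  then obtain i where "i \<in> {..<length fs} - U" "w (insert i U) \<noteq> 0"
    unfolding koszul_diff_def by (metis (no_types, lifting) mult_zero_right sum.neutral)
  then have i: "i \<notin> U" and U: "insert i U \<subseteq> {..<length fs}" and card: "card (insert i U) = 2"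
    using assms by (auto simp: koszul_chains_def)
  from U have "finite U" using finite_subset[of U "{..<length fs}"] by simp
  with i card have "card U = 1" by simp
  then show "\<exists>i<length fs. U = {i}" using U by (auto simp: card_1_singleton_iff)
qed

text \<open>Degree-two chains and alternating matrices determine each other on indices below
  \<open>length fs\<close>. In this form the sign bookkeeping of \<open>koszul_diff\<close>
  disappears from all later arguments.\<close>

lemma koszul_boundaries_1:
  "z \<in> koszul_boundaries fs (Suc 0) \<longleftrightarrow> z \<in> koszul_chains fs (Suc 0) \<and>
     (\<exists>b. alternating b \<and> (\<forall>i<length fs. z {i} = (\<Sum>j<length fs. b i j * fs ! j)))"
proof
  assume "z \<in> koszul_boundaries fs (Suc 0)"
  then obtain w where w: "w \<in> koszul_chains fs 2" and z: "z = koszul_diff fs w"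
    by (auto simp: koszul_boundaries_def numeral_2_eq_2)
  have "alternating (\<lambda>k j. if k < j then - w {k, j} else if j < k then w {k, j} else 0)"
    by (rule alternatingI) (auto simp: insert_commute)
  then show "z \<in> koszul_chains fs (Suc 0) \<and>
     (\<exists>b. alternating b \<and> (\<forall>i<length fs. z {i} = (\<Sum>j<length fs. b i j * fs ! j)))"
    unfolding z using koszul_diff_2_singleton koszul_diff_2_chain[OF w] by blast
next
  assume "z \<in> koszul_chains fs (Suc 0) \<and>
     (\<exists>b. alternating b \<and> (\<forall>i<length fs. z {i} = (\<Sum>j<length fs. b i j * fs ! j)))"
  then obtain b where z: "z \<in> koszul_chains fs (Suc 0)" and b: "alternating b"
    and eq: "\<And>i. i < length fs \<Longrightarrow> z {i} = (\<Sum>j<length fs. b i j * fs ! j)" by blast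
  \<comment> \<open>An unordered pair is read with its smaller index first. The minus sign
    compensates for the sign of deleting the larger index.\<close>
  define w where "w U = (if U \<subseteq> {..<length fs} \<and> card U = 2 then - b (Min U) (Max U) else 0)" for U
  have w: "w \<in> koszul_chains fs 2" by (auto simp: w_def koszul_chains_def split: if_splits)
  have wb: "(if k < j then - w {k, j} else if j < k then w {k, j} else 0) = b k j"
    if "k < length fs" "j < length fs" for k j
    using that alternatingD(1)[OF b, of k] alternatingD(2)[OF b, of k j]
    by (cases k j rule: linorder_cases) (auto simp: w_def)
  have "koszul_diff fs w U = z U" for U
  proof (cases "\<exists>k<length fs. U = {k}")
    case True
    then show ?thesis by (auto simp: koszul_diff_2_singleton eq wb intro!: sum.cong)
  next
    case False
    then show ?thesis using z koszul_diff_2_chain[OF w] unfolding koszul_chains_1 by metis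
  qed
  then have "z = koszul_diff fs w" by auto
  then show "z \<in> koszul_boundaries fs (Suc 0)" using w by (simp add: koszul_boundaries_def numeral_2_eq_2)
qed

section \<open>The first Koszul homology as a module over S/J, and its rank\<close>

locale koszul_point = generic_presentation \<pi> "length fs" h "(!) fs" g s m
  for \<pi> :: "'s::comm_ring_1 \<Rightarrow> 'f::field" and fs :: "'s list" and h g s m
begin

abbreviation J :: "'s set" where "J \<equiv> {x. \<pi> x = 0}"

definition cl :: "'s \<Rightarrow> 's set" where "cl x = {y. \<pi> y = \<pi> x}"

definition hcl :: "(nat set \<Rightarrow> 's) \<Rightarrow> (nat set \<Rightarrow> 's) set" where
  "hcl z = {y. \<exists>b\<in>koszul_boundaries fs (Suc 0). y = (\<lambda>U. b U + z U)}"

definition \<rho> :: "'s set \<Rightarrow> 'f" where "\<rho> \<gamma> = \<pi> (SOME c. c \<in> \<gamma>)"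

text \<open>Reduction of a homology class modulo J. The choice of the cycle does not matter because
  boundaries have all coordinates in J (\<open>boundary_\<pi>\<close>,
  \<open>\<mu>_hcl\<close>).\<close>

definition \<mu> :: "(nat set \<Rightarrow> 's) set \<Rightarrow> 'f vec" where
  "\<mu> \<eta> = vec (length fs) (\<lambda>i. \<pi> ((SOME z. z \<in> \<eta>) {i}))"

lemma \<rho>_cl: "\<rho> (cl x) = \<pi> x"
  unfolding \<rho>_def cl_def by (rule someI2[of _ x]) auto

lemma ideal_J: "ideal J class_ring"
proof (rule idealI)
  show R: "ring (class_ring :: 's ring)" by (rule class_ring.ring_axioms)
  show "subgroup J (add_monoid class_ring)"
  proof (rule group.subgroupI[OF abelian_group.a_group[OF ring.is_abelian_group[OF R]]], goal_cases)
    case (3 x)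
    have "inv\<^bsub>add_monoid class_ring\<^esub> x = - x"
      unfolding a_inv_def[symmetric] by (simp only: class_ring_simps)
    then show ?case using 3 by (simp only: mem_Collect_eq uminus) simp
  qed (auto simp: hom_simps intro: exI[of _ 0])
qed (auto simp: hom_simps)

lemma coset_J: "J +>\<^bsub>class_ring\<^esub> x = cl x"
proof
  show "cl x \<subseteq> J +>\<^bsub>class_ring\<^esub> x"
  proof
    fix y assume "y \<in> cl x"
    then have "\<pi> (y - x) = 0" by (simp add: cl_def diff)
    moreover have "y = (y - x) + x" by simp
    ultimately show "y \<in> J +>\<^bsub>class_ring\<^esub> x" unfolding a_r_coset_def' by force
  qed
qed (auto simp: a_r_coset_def' cl_def add)

lemma quot_ring:
  "carrier (class_ring Quot J) = range cl"
  "cl x \<otimes>\<^bsub>class_ring Quot J\<^esub> cl y = cl (x * y)"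
  "cl x \<oplus>\<^bsub>class_ring Quot J\<^esub> cl y = cl (x + y)"
  "\<zero>\<^bsub>class_ring Quot J\<^esub> = cl 0" "\<one>\<^bsub>class_ring Quot J\<^esub> = cl 1"
  using ideal.rcoset_mult_add[OF ideal_J, of x y] abelian_subgroup.a_rcos_sum[of J class_ring x y]
    ideal.axioms(1)[OF ideal_J]
  by (auto simp: FactRing_def A_RCOSETS_def' coset_J cl_def[of 0] zero
      additive_subgroup.a_subgroup abelian_subgroupI3 class_ring.abelian_group_axioms)

lemma cl_nonzero: "cl x \<in> carrier (class_ring Quot J) - {\<zero>\<^bsub>class_ring Quot J\<^esub>} \<longleftrightarrow> \<pi> x \<noteq> 0"
  using \<rho>_cl[of x] \<rho>_cl[of 0] by (auto simp: quot_ring zero cl_def)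

lemma fraction_field: "fraction_field_map (class_ring Quot J) \<rho>"
proof
  show "inj_on \<rho> (carrier (class_ring Quot J))"
    by (rule inj_onI) (auto simp: quot_ring \<rho>_cl, auto simp: cl_def)
  show "\<exists>a\<in>carrier (class_ring Quot J).
      \<exists>s\<in>carrier (class_ring Quot J) - {\<zero>\<^bsub>class_ring Quot J\<^esub>}. \<rho> a = \<rho> s * x" for x
  proof -
    obtain a s where "\<pi> s \<noteq> 0" "\<pi> a = \<pi> s * x" using frac by blast
    then have "\<rho> (cl a) = \<rho> (cl s) * x" "cl s \<in> carrier (class_ring Quot J) - {\<zero>\<^bsub>class_ring Quot J\<^esub>}"
      by (simp_all only: cl_nonzero \<rho>_cl not_False_eq_True)
    moreover have "cl a \<in> carrier (class_ring Quot J)" by (simp add: quot_ring)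
    ultimately show ?thesis by blast
  qed
qed (auto simp: quot_ring \<rho>_cl hom_simps)

lemma boundary_cycle:
  assumes b: "b \<in> koszul_boundaries fs (Suc 0)"
  shows "b \<in> carrier (koszul_cycles fs (Suc 0))"
proof -
  obtain \<beta> where \<beta>: "alternating \<beta>"
    and eq: "\<And>i. i < length fs \<Longrightarrow> b {i} = (\<Sum>j<length fs. \<beta> i j * fs ! j)"
    using b unfolding koszul_boundaries_1 by blast
  \<comment> \<open>An alternating form vanishes on equal arguments; the induction adds one row and
    one column that cancel, again without division by two.\<close>
  have "(\<Sum>i<N. (\<Sum>j<N. \<beta> i j * fs ! j) * fs ! i) = 0" for N
  proof (induction N)
    case (Suc N)
    have "(\<Sum>i<N. \<beta> i N * fs ! N * fs ! i) = (\<Sum>i<N. - (\<beta> N i * fs ! i * fs ! N))"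
    proof (rule sum.cong[OF refl])
      fix i
      show "\<beta> i N * fs ! N * fs ! i = - (\<beta> N i * fs ! i * fs ! N)"
        unfolding alternatingD(2)[OF \<beta>, of i N] by (simp add: mult_ac)
    qed
    then show ?case
      using Suc alternatingD(1)[OF \<beta>, of N]
      by (simp add: distrib_right sum.distrib sum_negf sum_distrib_right)
  qed simp
  then show ?thesis
    using b by (simp add: koszul_cycles_1 koszul_boundaries_1 eq)
qed

lemma boundary_zero: "(\<lambda>_. 0) \<in> koszul_boundaries fs (Suc 0)"
  unfolding koszul_boundaries_1 koszul_chains_1
  by (auto simp: alternating_def intro!: exI[of _ "\<lambda>_ _. 0"])

lemma chains_add:
  "x \<in> koszul_chains fs (Suc 0) \<Longrightarrow> y \<in> koszul_chains fs (Suc 0) \<Longrightarrow> (\<lambda>U. x U + y U) \<in> koszul_chains fs (Suc 0)"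
  unfolding koszul_chains_1 by (metis add.right_neutral)

lemma chains_smult: "x \<in> koszul_chains fs (Suc 0) \<Longrightarrow> (\<lambda>U. c * x U) \<in> koszul_chains fs (Suc 0)"
  unfolding koszul_chains_1 by (metis mult_zero_right)

lemma boundary_add:
  assumes "x \<in> koszul_boundaries fs (Suc 0)" "y \<in> koszul_boundaries fs (Suc 0)"
  shows "(\<lambda>U. x U + y U) \<in> koszul_boundaries fs (Suc 0)"
proof -
  obtain a b where a: "alternating a" "\<And>i. i < length fs \<Longrightarrow> x {i} = (\<Sum>j<length fs. a i j * fs ! j)"
    and b: "alternating b" "\<And>i. i < length fs \<Longrightarrow> y {i} = (\<Sum>j<length fs. b i j * fs ! j)"
    using assms unfolding koszul_boundaries_1 by blast
  have "alternating (\<lambda>i j. a i j + b i j)"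
  proof (rule alternatingI)
    show "a i j + b i j = - (a j i + b j i)" for i j
      unfolding alternatingD(2)[OF a(1), of i j] alternatingD(2)[OF b(1), of i j] by simp
  qed (simp add: alternatingD(1)[OF a(1)] alternatingD(1)[OF b(1)])
  then show ?thesis
    using assms unfolding koszul_boundaries_1
    by (auto simp: chains_add a(2) b(2) distrib_right sum.distrib intro!: exI[of _ "\<lambda>i j. a i j + b i j"])
qed

lemma boundary_smult:
  assumes "x \<in> koszul_boundaries fs (Suc 0)"
  shows "(\<lambda>U. c * x U) \<in> koszul_boundaries fs (Suc 0)"
proof -
  obtain a where a: "alternating a" "\<And>i. i < length fs \<Longrightarrow> x {i} = (\<Sum>j<length fs. a i j * fs ! j)"
    using assms unfolding koszul_boundaries_1 by blast
  have "alternating (\<lambda>i j. c * a i j)"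
  proof (rule alternatingI)
    show "c * a i j = - (c * a j i)" for i j
      unfolding alternatingD(2)[OF a(1), of i j] by simp
  qed (simp add: alternatingD(1)[OF a(1)])
  then show ?thesis
    using assms unfolding koszul_boundaries_1
    by (auto simp: chains_smult a(2) sum_distrib_left mult.assoc intro!: exI[of _ "\<lambda>i j. c * a i j"])
qed

lemma boundary_diff:
  assumes "x \<in> koszul_boundaries fs (Suc 0)" "y \<in> koszul_boundaries fs (Suc 0)"
  shows "(\<lambda>U. x U - y U) \<in> koszul_boundaries fs (Suc 0)"
  using boundary_add[OF assms(1) boundary_smult[OF assms(2), of "- 1"]] by simp

lemma boundary_\<pi>:
  assumes "b \<in> koszul_boundaries fs (Suc 0)" "i < length fs"
  shows "\<pi> (b {i}) = 0"
proof -
  obtain \<beta> where "b {i} = (\<Sum>j<length fs. \<beta> i j * fs ! j)"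
    using assms unfolding koszul_boundaries_1 by blast
  then show ?thesis by (simp add: hom_simps f_mem)
qed

lemma cycles_add:
  "x \<in> carrier (koszul_cycles fs (Suc 0)) \<Longrightarrow> y \<in> carrier (koszul_cycles fs (Suc 0)) \<Longrightarrow>
    (\<lambda>U. x U + y U) \<in> carrier (koszul_cycles fs (Suc 0))"
  by (simp add: koszul_cycles_1 chains_add distrib_right sum.distrib)

lemma cycles_smult:
  "x \<in> carrier (koszul_cycles fs (Suc 0)) \<Longrightarrow> (\<lambda>U. c * x U) \<in> carrier (koszul_cycles fs (Suc 0))"
  by (simp add: koszul_cycles_1 chains_smult sum_distrib_left[symmetric] mult.assoc)

text \<open>J annihilates the homology: for \<open>c\<close> the value of \<open>w\<close> on
  \<open>fs\<close>, the wedge of \<open>z\<close> and \<open>w\<close> bounds \<open>c * z\<close>,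
  since its other term carries the value of the cycle \<open>z\<close>, which is zero.\<close>

lemma ideal_cycle_boundary:
  assumes c: "\<pi> c = 0" and z: "z \<in> carrier (koszul_cycles fs (Suc 0))"
  shows "(\<lambda>U. c * z U) \<in> koszul_boundaries fs (Suc 0)"
proof -
  obtain w where w: "c = (\<Sum>l<length fs. w l * fs ! l)" using f_gen[OF c] by blast
  define b where "b i j = z {i} * w j - w i * z {j}" for i j
  have "alternating b" by (rule alternatingI) (simp_all add: b_def algebra_simps)
  moreover have "c * z {i} = (\<Sum>j<length fs. b i j * fs ! j)" if "i < length fs" for i
  proof -
    have "(\<Sum>j<length fs. b i j * fs ! j) =
        z {i} * (\<Sum>j<length fs. w j * fs ! j) - w i * (\<Sum>j<length fs. z {j} * fs ! j)"
      by (simp add: b_def left_diff_distrib sum_subtractf sum_distrib_left mult.assoc)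
    then show ?thesis using z by (simp add: w[symmetric] koszul_cycles_1 mult.commute[of _ c])
  qed
  ultimately show ?thesis
    using z by (auto simp: koszul_boundaries_1 koszul_cycles_1 chains_smult)
qed

lemma hcl_mem: "y \<in> hcl z \<longleftrightarrow> (\<lambda>U. y U - z U) \<in> koszul_boundaries fs (Suc 0)"
proof
  assume "(\<lambda>U. y U - z U) \<in> koszul_boundaries fs (Suc 0)"
  then show "y \<in> hcl z" unfolding hcl_def by (auto intro!: bexI[of _ "\<lambda>U. y U - z U"])
qed (auto simp: hcl_def)

lemma hcl_eq:
  assumes "(\<lambda>U. y U - z U) \<in> koszul_boundaries fs (Suc 0)"
  shows "hcl y = hcl z"
  unfolding set_eq_iff
proof
  fix x
  show "x \<in> hcl y \<longleftrightarrow> x \<in> hcl z"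
    using boundary_add[OF _ assms, of "\<lambda>U. x U - y U"] boundary_diff[OF _ assms, of "\<lambda>U. x U - z U"]
    by (auto simp: hcl_mem)
qed

lemma hcl_self: "z \<in> hcl z"
  by (simp add: hcl_mem boundary_zero)

lemma \<mu>_hcl: "\<mu> (hcl z) = vec (length fs) (\<lambda>i. \<pi> (z {i}))"
proof -
  have "(SOME y. y \<in> hcl z) \<in> hcl z" by (rule someI[of _ z]) (rule hcl_self)
  then have b: "(\<lambda>U. (SOME y. y \<in> hcl z) U - z U) \<in> koszul_boundaries fs (Suc 0)" unfolding hcl_mem .
  have "\<pi> ((SOME y. y \<in> hcl z) {i}) = \<pi> (z {i})" if "i < length fs" for i
    using boundary_\<pi>[OF b that] by (simp add: diff)
  then show ?thesis by (intro eq_vecI) (simp_all add: \<mu>_def)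
qed

lemma homology_carrier: "carrier (koszul_homology fs (Suc 0)) = hcl ` carrier (koszul_cycles fs (Suc 0))"
  and homology_zero: "\<zero>\<^bsub>koszul_homology fs (Suc 0)\<^esub> = hcl (\<lambda>_. 0)"
  by (auto simp: koszul_homology_def Let_def A_RCOSETS_def' a_r_coset_def' hcl_def koszul_cycles_def)

lemma homology_add:
  "hcl y \<oplus>\<^bsub>koszul_homology fs (Suc 0)\<^esub> hcl z = hcl (\<lambda>U. y U + z U)"
proof
  show "hcl (\<lambda>U. y U + z U) \<subseteq> hcl y \<oplus>\<^bsub>koszul_homology fs (Suc 0)\<^esub> hcl z"
  proof
    fix x assume "x \<in> hcl (\<lambda>U. y U + z U)"
    then have "(\<lambda>U. (x U - z U) - y U) \<in> koszul_boundaries fs (Suc 0)"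
      by (simp add: hcl_mem algebra_simps)
    then have "(\<lambda>U. x U - z U) \<in> hcl y" by (simp add: hcl_mem)
    then have "\<exists>a\<in>hcl y. \<exists>b\<in>hcl z. x = (\<lambda>U. a U + b U)"
      by (rule bexI[rotated]) (rule bexI[of _ z], simp_all add: hcl_self)
    then show "x \<in> hcl y \<oplus>\<^bsub>koszul_homology fs (Suc 0)\<^esub> hcl z"
      by (auto simp: koszul_homology_def Let_def set_add_def' koszul_cycles_def)
  qed
next
  show "hcl y \<oplus>\<^bsub>koszul_homology fs (Suc 0)\<^esub> hcl z \<subseteq> hcl (\<lambda>U. y U + z U)"
  proof
    fix x assume "x \<in> hcl y \<oplus>\<^bsub>koszul_homology fs (Suc 0)\<^esub> hcl z"
    then obtain a b where a: "a \<in> hcl y" and b: "b \<in> hcl z" and x: "x = (\<lambda>U. a U + b U)"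
      by (auto simp: koszul_homology_def Let_def set_add_def' koszul_cycles_def)
    show "x \<in> hcl (\<lambda>U. y U + z U)"
      using boundary_add[OF a[unfolded hcl_mem] b[unfolded hcl_mem]]
      by (simp add: hcl_mem x algebra_simps)
  qed
qed

text \<open>The defining union ranges over representatives of the scalar as well as of the class.
  Changing the class representative adds a multiple of a boundary; changing the scalar adds an
  element of J times a cycle, a boundary by \<open>ideal_cycle_boundary\<close>.\<close>

lemma homology_smult:
  assumes z: "z \<in> carrier (koszul_cycles fs (Suc 0))"
  shows "cl c \<odot>\<^bsub>koszul_homology fs (Suc 0)\<^esub> hcl z = hcl (\<lambda>U. c * z U)"
proof -
  have eq: "hcl (\<lambda>U. d * y U) = hcl (\<lambda>U. c * z U)" if d: "d \<in> cl c" and y: "y \<in> hcl z" for d y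
  proof (rule hcl_eq)
    have "(\<lambda>U. d * (y U - z U)) \<in> koszul_boundaries fs (Suc 0)"
      using boundary_smult[OF y[unfolded hcl_mem]] .
    moreover have "(\<lambda>U. (d - c) * z U) \<in> koszul_boundaries fs (Suc 0)"
      by (rule ideal_cycle_boundary[OF _ z]) (use d in \<open>simp add: cl_def diff\<close>)
    ultimately have "(\<lambda>U. d * (y U - z U) + (d - c) * z U) \<in> koszul_boundaries fs (Suc 0)"
      by (rule boundary_add)
    then show "(\<lambda>U. d * y U - c * z U) \<in> koszul_boundaries fs (Suc 0)" by (simp add: algebra_simps)
  qed
  have "cl c \<odot>\<^bsub>koszul_homology fs (Suc 0)\<^esub> hcl z = (\<Union>d\<in>cl c. \<Union>y\<in>hcl z. hcl (\<lambda>U. d * y U))"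
    by (auto simp: koszul_homology_def Let_def a_r_coset_def' hcl_def koszul_cycles_def)
  also have "\<dots> = (\<Union>d\<in>cl c. \<Union>y\<in>hcl z. hcl (\<lambda>U. c * z U))"
    by (intro SUP_cong refl eq)
  also have "\<dots> = hcl (\<lambda>U. c * z U)"
  proof -
    have "c \<in> cl c" by (simp add: cl_def)
    then show ?thesis using hcl_self[of z] by blast
  qed
  finally show ?thesis .
qed

text \<open>\<open>A\<close> is the map k^n -> k^h given by \<open>m\<close>, with kernel
  \<open>W\<close>. The reduction \<open>\<mu>\<close> identifies the localized homology with
  \<open>W\<close>, and rank-nullity applies to \<open>A\<close>, which is onto by
  \<open>m_surj\<close>.\<close>

lemma rank_koszul_homology:
  "module_rank (class_ring Quot J) (koszul_homology fs (Suc 0)) + h = length fs"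
proof -
  define A where "A = mat h (length fs) (\<lambda>(k, i). \<pi> (m i k))"
  have A: "A \<in> carrier_mat h (length fs)" by (simp add: A_def)
  define W where "W = (module_vec TYPE('f) (length fs))\<lparr>carrier := {v \<in> carrier_vec (length fs). A *\<^sub>v v = 0\<^sub>v h}\<rparr>"
  have Av: "A *\<^sub>v v = w \<longleftrightarrow> (\<forall>k<h. (\<Sum>i<length fs. \<pi> (m i k) * v $ i) = w $ k)"
    if "v \<in> carrier_vec (length fs)" "w \<in> carrier_vec h" for v w
    using that by (auto simp: A_def vec_eq_iff scalar_prod_def lessThan_atLeast0)
  have surj: "\<exists>v\<in>carrier_vec (length fs). A *\<^sub>v v = w" if w: "w \<in> carrier_vec h" for w
  proof -
    obtain v where v: "\<forall>k<h. (\<Sum>i<length fs. \<pi> (m i k) * v i) = w $ k" using m_surj[of "($) w"] by blast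
    show ?thesis
      by (rule bexI[of _ "vec (length fs) v"]) (simp_all add: Av[OF _ w] v)
  qed
  note W_dim = dim_surj_mat_kernel[OF A surj, folded W_def]
  have W_carrier: "v \<in> carrier W \<longleftrightarrow> v \<in> carrier_vec (length fs) \<and>
      (\<forall>k<h. (\<Sum>i<length fs. \<pi> (m i k) * v $ i) = 0)" for v
    using Av[of v "0\<^sub>v h"] by (auto simp: W_def)
  have W_ops: "x \<oplus>\<^bsub>W\<^esub> y = x + y" "a \<odot>\<^bsub>W\<^esub> x = a \<cdot>\<^sub>v x" "\<zero>\<^bsub>W\<^esub> = 0\<^sub>v (length fs)" for x y a
    by (simp_all add: W_def module_vec_simps)
  interpret generic_fibre "class_ring Quot J" \<rho> "koszul_homology fs (Suc 0)" \<mu> W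
  proof (rule generic_fibre.intro[OF fraction_field generic_fibre_axioms.intro], goal_cases)
    case 1 show ?case by (rule W_dim(1))
  next
    case 2 show ?case
      using boundary_cycle[OF boundary_zero] by (simp add: homology_carrier homology_zero)
  next
    case (3 x y) then show ?case by (auto simp: homology_carrier homology_add cycles_add)
  next
    case (4 a x) then show ?case by (auto simp: homology_carrier quot_ring homology_smult cycles_smult)
  next
    case (5 x)
    then show ?case by (auto simp: homology_carrier \<mu>_hcl W_carrier koszul_cycles_1 cycle_relation)
  next
    case 6 show ?case by (auto simp: homology_zero \<mu>_hcl W_ops zero)
  next
    case (7 x y) then show ?case by (auto simp: homology_carrier homology_add \<mu>_hcl W_ops add)
  next
    case (8 a x)
    then show ?case by (auto simp: homology_carrier quot_ring homology_smult \<mu>_hcl W_ops mult \<rho>_cl)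
  next
    \<comment> \<open>Two classes with the same reduction differ by a cycle with coefficients in J,
      which a multiplier outside J turns into a boundary.\<close>
    case (9 x y)
    then obtain v w where v: "v \<in> carrier (koszul_cycles fs (Suc 0))" "x = hcl v"
      and w: "w \<in> carrier (koszul_cycles fs (Suc 0))" "y = hcl w"
      by (auto simp: homology_carrier)
    define z where "z = (\<lambda>U. v U + - 1 * w U)"
    have z: "z \<in> carrier (koszul_cycles fs (Suc 0))"
      unfolding z_def by (intro cycles_add cycles_smult v(1) w(1))
    have "\<pi> (z {i}) = 0" if "i < length fs" for i
    proof -
      have "\<mu> x $ i = \<mu> y $ i" using 9 by simp
      then show ?thesis using that by (simp add: v(2) w(2) \<mu>_hcl z_def hom_simps)
    qed
    with cycle_in_kernel_boundary[of "\<lambda>i. z {i}"] z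
    obtain u b where u: "\<pi> u \<noteq> 0" and b: "alternating b"
      "\<forall>i<length fs. u * z {i} = (\<Sum>j<length fs. b i j * fs ! j)"
      by (auto simp: koszul_cycles_1)
    have "(\<lambda>U. u * z U) \<in> koszul_boundaries fs (Suc 0)"
      unfolding koszul_boundaries_1 using b z by (auto simp: koszul_cycles_1 chains_smult)
    then have "(\<lambda>U. u * v U - u * w U) \<in> koszul_boundaries fs (Suc 0)"
      by (simp add: z_def right_diff_distrib)
    from hcl_eq[OF this] show ?case
      using u by (intro bexI[of _ "cl u"]) (simp_all only: cl_nonzero v w homology_smult not_False_eq_True)
  next
    \<comment> \<open>Every relation in \<open>W\<close> is, up to a scalar, the reduction of a
      genuine cycle; \<open>y\<close> is that cycle written as a Koszul chain on singletons.\<close>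
    case (10 w)
    then obtain z t where t: "\<pi> t \<noteq> 0" and z: "(\<Sum>i<length fs. z i * fs ! i) = 0"
      and eq: "\<And>i. i < length fs \<Longrightarrow> \<pi> (z i) = \<pi> t * w $ i"
      using relation_lift[of "($) w"] unfolding W_carrier by blast
    define y where "y U = (if \<exists>i<length fs. U = {i} then z (the_elem U) else 0)" for U
    have y: "y {i} = z i" if "i < length fs" for i using that by (simp add: y_def)
    have "y \<in> carrier (koszul_cycles fs (Suc 0))"
      using z by (auto simp: koszul_cycles_1 koszul_chains_1 y) (auto simp: y_def split: if_splits)
    then have "hcl y \<in> carrier (koszul_homology fs (Suc 0))" unfolding homology_carrier by (rule imageI)
    moreover have "\<mu> (hcl y) = \<rho> (cl t) \<odot>\<^bsub>W\<^esub> w"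
      using 10 by (intro eq_vecI) (auto simp: \<mu>_hcl W_ops W_carrier \<rho>_cl y eq)
    ultimately show ?case
      using t by (intro bexI[of _ "hcl y"] bexI[of _ "cl t"]) (simp_all only: cl_nonzero not_False_eq_True)
  qed
  show ?thesis using module_rank_eq_dim W_dim(2) by simp
qed

end

section \<open>Evaluation of polynomials\<close>

lemma poly_mapping_sum_single:
  "p = (\<Sum>m\<in>Poly_Mapping.keys p. Poly_Mapping.single m (Poly_Mapping.lookup p m))"
  by (rule poly_mapping_eqI)
    (auto simp: lookup_sum lookup_single when_def in_keys_iff sum.delta[OF finite_keys])

lemma mpoly_induct [case_names const var plus times]:
  fixes p :: "('v::finite, 'a::comm_ring_1) mpoly"
  assumes const: "\<And>a. P (Poly_Mapping.single 0 a)"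
    and var: "\<And>v. P (Poly_Mapping.single (Poly_Mapping.single v 1) 1)"
    and plus: "\<And>p q. P p \<Longrightarrow> P q \<Longrightarrow> P (p + q)"
    and times: "\<And>p q. P p \<Longrightarrow> P q \<Longrightarrow> P (p * q)"
  shows "P p"
proof -
  have mon: "P (Poly_Mapping.single m 1)" for m :: "'v \<Rightarrow>\<^sub>0 nat"
  proof (induction "\<Sum>v\<in>UNIV. Poly_Mapping.lookup m v" arbitrary: m)
    case 0
    then have "m = 0" by (intro poly_mapping_eqI) simp
    then show ?case using const[of 1] by simp
  next
    case (Suc k)
    then obtain v where v: "Poly_Mapping.lookup m v \<noteq> 0"
      by (metis Zero_not_Suc sum.neutral)
    define m' where "m' = m - Poly_Mapping.single v 1"
    have m: "m = Poly_Mapping.single v 1 + m'"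
      using v by (intro poly_mapping_eqI) (auto simp: m'_def lookup_add lookup_minus lookup_single when_def)
    have "Suc k = 1 + (\<Sum>v\<in>UNIV. Poly_Mapping.lookup m' v)"
      unfolding Suc.hyps(2) by (subst m) (simp add: lookup_add sum.distrib lookup_single when_def)
    then have "P (Poly_Mapping.single m' 1)" by (intro Suc.hyps(1)) simp
    from times[OF var[of v] this] show ?case by (simp add: mult_single m)
  qed
  have "P (\<Sum>m\<in>K. Poly_Mapping.single m (Poly_Mapping.lookup p m))" if "finite K" for K
    using that
  proof induction
    case empty
    then show ?case using const[of 0] by simp
  next
    case (insert m K)
    have "P (Poly_Mapping.single m (Poly_Mapping.lookup p m))"
      using times[OF const[of "Poly_Mapping.lookup p m"] mon[of m]] by (simp add: mult_single)
    then show ?case using insert by (simp add: plus)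
  qed
  from this[OF finite_keys, of p] show ?thesis using poly_mapping_sum_single[of p] by simp
qed

text \<open>Constants, t and its inverse generate the Laurent polynomials as a ring. This reduces
  the search for common denominators to these three kinds of elements.\<close>

lemma laurent_induct [case_names const t t_inv plus times]:
  fixes p :: "'a::comm_ring_1 laurent"
  assumes const: "\<And>a. P (Poly_Mapping.single 0 a)"
    and t: "P (Poly_Mapping.single 1 1)" and t_inv: "P (Poly_Mapping.single (- 1) 1)"
    and plus: "\<And>p q. P p \<Longrightarrow> P q \<Longrightarrow> P (p + q)"
    and times: "\<And>p q. P p \<Longrightarrow> P q \<Longrightarrow> P (p * q)"
  shows "P p"
proof -
  have mon: "P (Poly_Mapping.single k 1)" for k :: int
  proof (induction k rule: int_induct[where k = 0])
    case base
    show ?case using const[of 1] by simp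
  next
    case (step1 i)
    from times[OF this(2) t] show ?case by (simp add: mult_single)
  next
    case (step2 i)
    from times[OF this(2) t_inv] show ?case by (simp add: mult_single)
  qed
  have "P (\<Sum>m\<in>K. Poly_Mapping.single m (Poly_Mapping.lookup p m))" if "finite K" for K
    using that
  proof induction
    case empty
    then show ?case using const[of 0] by simp
  next
    case (insert m K)
    have "P (Poly_Mapping.single m (Poly_Mapping.lookup p m))"
      using times[OF const[of "Poly_Mapping.lookup p m"] mon[of m]] by (simp add: mult_single)
    then show ?case using insert by (simp add: plus)
  qed
  from this[OF finite_keys, of p] show ?thesis using poly_mapping_sum_single[of p] by simp
qed

section \<open>Evaluation as a ring map into Laurent polynomials\<close>

abbreviation laurent_eval :: "('v::finite \<Rightarrow> 'a::comm_ring_1 laurent) \<Rightarrow> ('v, 'a) mpoly \<Rightarrow> 'a laurent" where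
  "laurent_eval \<equiv> mpoly_eval (Poly_Mapping.single 0)"

lemma laurent_eval_superset:
  assumes "finite K" "Poly_Mapping.keys p \<subseteq> K"
  shows "laurent_eval x p = (\<Sum>m\<in>K. Poly_Mapping.single 0 (Poly_Mapping.lookup p m) *
    (\<Prod>v\<in>UNIV. x v ^ Poly_Mapping.lookup m v))"
  unfolding mpoly_eval_def
  by (rule sum.mono_neutral_left[OF assms]) (auto simp: in_keys_iff)

lemma laurent_eval_add: "laurent_eval x (p + q) = laurent_eval x p + laurent_eval x q"
proof -
  let ?K = "Poly_Mapping.keys p \<union> Poly_Mapping.keys q"
  have "finite ?K" by simp
  then show ?thesis
    using laurent_eval_superset[of ?K "p + q" x] laurent_eval_superset[of ?K p x]
      laurent_eval_superset[of ?K q x] keys_add[of p q]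
    by (simp add: lookup_add single_add distrib_right sum.distrib)
qed

lemma laurent_eval_single:
  "laurent_eval x (Poly_Mapping.single m a) =
    Poly_Mapping.single 0 a * (\<Prod>v\<in>UNIV. x v ^ Poly_Mapping.lookup m v)"
  by (subst laurent_eval_superset[of "{m}"]) auto

lemma laurent_eval_sum: "laurent_eval x (sum F K) = (\<Sum>i\<in>K. laurent_eval x (F i))"
  by (induction K rule: infinite_finite_induct) (simp_all add: laurent_eval_add mpoly_eval_def[of _ _ 0])

lemma laurent_eval_mult:
  fixes p q :: "('v::finite, 'b::comm_ring_1) mpoly"
  shows "laurent_eval x (p * q) = laurent_eval x p * laurent_eval x q"
proof -
  have single: "laurent_eval x (Poly_Mapping.single m a * Poly_Mapping.single n b) =
      laurent_eval x (Poly_Mapping.single m a) * laurent_eval x (Poly_Mapping.single n b)" for m n a b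
  proof -
    have "Poly_Mapping.single 0 (a * b) = Poly_Mapping.single 0 a * (Poly_Mapping.single 0 b :: 'b laurent)"
      by (simp add: mult_single)
    then show ?thesis
      unfolding mult_single[of m a n b] laurent_eval_single
      by (simp add: lookup_add power_add prod.distrib mult_ac)
  qed
  have "laurent_eval x ((\<Sum>m\<in>K. Poly_Mapping.single m (P m)) * (\<Sum>n\<in>L. Poly_Mapping.single n (Q n))) =
      laurent_eval x (\<Sum>m\<in>K. Poly_Mapping.single m (P m)) *
      laurent_eval x (\<Sum>n\<in>L. Poly_Mapping.single n (Q n))" for K L P Q
    by (simp only: sum_product laurent_eval_sum single)
  from this[where K = "Poly_Mapping.keys p" and L = "Poly_Mapping.keys q"
      and P = "Poly_Mapping.lookup p" and Q = "Poly_Mapping.lookup q"]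
  show ?thesis by (simp only: poly_mapping_sum_single[symmetric])
qed

lemma laurent_eval_const: "laurent_eval x (Poly_Mapping.single 0 a) = Poly_Mapping.single 0 a"
  by (simp add: laurent_eval_single)

lemma laurent_eval_var: "laurent_eval x (Poly_Mapping.single (Poly_Mapping.single v 1) 1) = x v"
proof -
  have "(\<Prod>u\<in>UNIV. x u ^ Poly_Mapping.lookup (Poly_Mapping.single v 1) u) =
      (\<Prod>u\<in>UNIV. if u = v then x u else 1)"
    by (rule prod.cong) (auto simp: lookup_single when_def)
  then show ?thesis by (simp add: laurent_eval_single)
qed

lemma single_power: "Poly_Mapping.single (k::int) (a::'a::comm_ring_1) ^ n = Poly_Mapping.single (int n * k) (a ^ n)"
  by (induction n) (simp_all add: mult_single algebra_simps)

lemma lookup_single_mult: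
  fixes m :: "'k::cancel_comm_monoid_add" and a :: "'a::comm_ring_1"
  shows "Poly_Mapping.lookup (Poly_Mapping.single m a * p) (m + n) = a * Poly_Mapping.lookup p n"
proof -
  have "Poly_Mapping.single m a * p =
      (\<Sum>l\<in>Poly_Mapping.keys p. Poly_Mapping.single (m + l) (a * Poly_Mapping.lookup p l))"
    by (subst (1) poly_mapping_sum_single[of p]) (simp add: sum_distrib_left mult_single)
  then have "Poly_Mapping.lookup (Poly_Mapping.single m a * p) (m + n) =
      (\<Sum>l\<in>Poly_Mapping.keys p. if l = n then a * Poly_Mapping.lookup p n else 0)"
    by (auto simp: lookup_sum lookup_single when_def intro!: sum.cong)
  then show ?thesis by (auto simp: in_keys_iff)
qed

text \<open>Degrees in the single variable \<open>v\<close> are compared. If \<open>n\<close> has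
  the largest \<open>v\<close>-degree in \<open>x\<close>, the coefficient at \<open>k + n\<close>
  comes from the first term alone and equals \<open>c\<close> times that of \<open>x\<close> at
  \<open>n\<close>, so it cannot cancel.\<close>

lemma leading_term_cancel:
  fixes x t :: "('v, 'a::idom) mpoly"
  assumes eq: "(Poly_Mapping.single k c - Poly_Mapping.single l a) * x + t = 0"
    and c: "c \<noteq> 0" and less: "Poly_Mapping.lookup l v < Poly_Mapping.lookup k v"
    and t: "\<And>n. n \<in> Poly_Mapping.keys t \<Longrightarrow> Poly_Mapping.lookup n v < Poly_Mapping.lookup k v"
  shows "x = 0"
proof (rule ccontr)
  assume "x \<noteq> 0"
  then have ne: "Poly_Mapping.keys x \<noteq> {}" by simp
  define N where "N = Max ((\<lambda>n. Poly_Mapping.lookup n v) ` Poly_Mapping.keys x)"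
  have "N \<in> (\<lambda>n. Poly_Mapping.lookup n v) ` Poly_Mapping.keys x"
    unfolding N_def using ne by (intro Max_in) auto
  then obtain n where n: "n \<in> Poly_Mapping.keys x" and N: "N = Poly_Mapping.lookup n v" by blast
  have max: "Poly_Mapping.lookup n' v \<le> Poly_Mapping.lookup n v" if "n' \<in> Poly_Mapping.keys x" for n'
    unfolding N[symmetric] N_def using that by (intro Max_ge) auto
  have "Poly_Mapping.lookup t (k + n) = 0"
    using t[of "k + n"] by (auto simp: in_keys_iff lookup_add)
  moreover have "Poly_Mapping.lookup (Poly_Mapping.single l a * x) (k + n) = 0"
  proof (rule ccontr)
    assume "Poly_Mapping.lookup (Poly_Mapping.single l a * x) (k + n) \<noteq> 0"
    then have "k + n \<in> Poly_Mapping.keys (Poly_Mapping.single l a * x)" by (simp add: in_keys_iff)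
    then obtain n' where n': "n' \<in> Poly_Mapping.keys x" and kn: "k + n = l + n'"
      using keys_mult[of "Poly_Mapping.single l a" x] by (auto split: if_splits)
    from arg_cong[OF kn, of "\<lambda>m. Poly_Mapping.lookup m v"] show False
      using max[OF n'] less by (simp add: lookup_add)
  qed
  moreover from eq have "Poly_Mapping.lookup
      ((Poly_Mapping.single k c - Poly_Mapping.single l a) * x + t) (k + n) = 0" by simp
  ultimately have "c * Poly_Mapping.lookup x n = 0"
    by (simp add: lookup_add left_diff_distrib lookup_minus lookup_single_mult)
  then show False using c n by (simp add: in_keys_iff)
qed

definition avoiding :: "'v set \<Rightarrow> ('v, 'a::comm_ring_1) mpoly set" where
  "avoiding U = {f. \<forall>m\<in>Poly_Mapping.keys f. \<forall>v\<in>U. Poly_Mapping.lookup m v = 0}"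

lemma avoiding_closed:
  "f \<in> avoiding U \<Longrightarrow> g \<in> avoiding U \<Longrightarrow> f + g \<in> avoiding U"
  "f \<in> avoiding U \<Longrightarrow> g \<in> avoiding U \<Longrightarrow> f - g \<in> avoiding U"
  "f \<in> avoiding U \<Longrightarrow> g \<in> avoiding U \<Longrightarrow> f * g \<in> avoiding U"
  "0 \<in> avoiding U" "1 \<in> avoiding U"
proof -
  assume "f \<in> avoiding U" "g \<in> avoiding U"
  then show "f + g \<in> avoiding U" using keys_add[of f g] by (auto simp: avoiding_def)
next
  assume "f \<in> avoiding U" "g \<in> avoiding U"
  moreover have "Poly_Mapping.keys (f - g) \<subseteq> Poly_Mapping.keys f \<union> Poly_Mapping.keys g"
    by (auto simp: in_keys_iff lookup_minus)
  ultimately show "f - g \<in> avoiding U" by (auto simp: avoiding_def)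
next
  assume "f \<in> avoiding U" "g \<in> avoiding U"
  then show "f * g \<in> avoiding U" using keys_mult[of f g] by (fastforce simp: avoiding_def lookup_add)
qed (auto simp: avoiding_def)

lemma avoiding_single:
  "(\<And>v. v \<in> U \<Longrightarrow> Poly_Mapping.lookup m v = 0) \<Longrightarrow> Poly_Mapping.single m a \<in> avoiding U"
  by (auto simp: avoiding_def)

text \<open>The variable at \<open>v0\<close> goes to \<open>c\<close> t, so distinct powers of it
  land in distinct degrees of t, and each coefficient is only scaled by a power of
  \<open>c\<close>.\<close>

lemma laurent_eval_inj_on_one_variable:
  fixes F :: "('v::finite, 'a::idom) mpoly"
  assumes F: "F \<in> avoiding (- {v0})" and x: "x v0 = Poly_Mapping.single 1 c" and c: "c \<noteq> 0"
    and ev: "laurent_eval x F = 0"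
  shows "F = 0"
proof (rule poly_mapping_eqI)
  have m: "m = Poly_Mapping.single v0 (Poly_Mapping.lookup m v0)" if "m \<in> Poly_Mapping.keys F" for m
    using that F by (intro poly_mapping_eqI) (auto simp: avoiding_def lookup_single when_def)
  have mono: "(\<Prod>v\<in>UNIV. x v ^ Poly_Mapping.lookup m v) =
      Poly_Mapping.single (int (Poly_Mapping.lookup m v0)) (c ^ Poly_Mapping.lookup m v0)"
    if "m \<in> Poly_Mapping.keys F" for m
  proof -
    have "(\<Prod>v\<in>UNIV. x v ^ Poly_Mapping.lookup m v) =
        (\<Prod>v\<in>UNIV. if v = v0 then x v0 ^ Poly_Mapping.lookup m v0 else 1)"
      using that F by (intro prod.cong) (auto simp: avoiding_def)
    then show ?thesis by (simp add: x single_power)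
  qed
  fix m
  show "Poly_Mapping.lookup F m = Poly_Mapping.lookup 0 m"
  proof (cases "m \<in> Poly_Mapping.keys F")
    case True
    let ?d = "int (Poly_Mapping.lookup m v0)"
    have "laurent_eval x F = (\<Sum>n\<in>Poly_Mapping.keys F.
        Poly_Mapping.single (int (Poly_Mapping.lookup n v0))
          (Poly_Mapping.lookup F n * c ^ Poly_Mapping.lookup n v0))"
      unfolding mpoly_eval_def by (rule sum.cong) (simp_all add: mono mult_single)
    then have "Poly_Mapping.lookup (laurent_eval x F) ?d = (\<Sum>n\<in>Poly_Mapping.keys F.
        Poly_Mapping.lookup F n * c ^ Poly_Mapping.lookup n v0
          when Poly_Mapping.lookup n v0 = Poly_Mapping.lookup m v0)"
      by (simp add: lookup_sum lookup_single)
    also have "\<dots> = (\<Sum>n\<in>Poly_Mapping.keys F.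
        if n = m then Poly_Mapping.lookup F m * c ^ Poly_Mapping.lookup m v0 else 0)"
    proof (rule sum.cong[OF refl])
      fix n assume "n \<in> Poly_Mapping.keys F"
      then have "Poly_Mapping.lookup n v0 = Poly_Mapping.lookup m v0 \<longleftrightarrow> n = m"
        using m[of n] m[OF True] by metis
      then show "(Poly_Mapping.lookup F n * c ^ Poly_Mapping.lookup n v0
          when Poly_Mapping.lookup n v0 = Poly_Mapping.lookup m v0) =
          (if n = m then Poly_Mapping.lookup F m * c ^ Poly_Mapping.lookup m v0 else 0)"
        by (simp add: when_def)
    qed
    finally have "Poly_Mapping.lookup (laurent_eval x F) ?d =
        (\<Sum>n\<in>Poly_Mapping.keys F. if n = m then Poly_Mapping.lookup F m * c ^ Poly_Mapping.lookup m v0 else 0)" .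
    then have "Poly_Mapping.lookup F m * c ^ Poly_Mapping.lookup m v0 = 0"
      using True ev by simp
    then show ?thesis using c by simp
  qed (simp add: in_keys_iff)
qed

section \<open>The defining ideals of the Rees algebras\<close>

context generic_point
begin

lemma generically_exact_0: "generically_exact 0 g"
  unfolding generically_exact_def by (auto simp: alternating_def one intro!: exI[of _ 1] exI[of _ "\<lambda>_ _. 0"])

text \<open>Modulo \<open>g h\<close> everything can be moved, up to a denominator, into the subring \<open>T\<close>, which meets the
  ideal of \<open>g h\<close> trivially. This splits a syzygy of \<open>g 0, \<dots>, g h\<close> into Koszul syzygies with
  \<open>g h\<close> and a syzygy of \<open>g 0, \<dots>, g (h - 1)\<close> with coefficients in \<open>T\<close>.\<close>

lemma generically_exact_Suc:
  assumes exact: "generically_exact h g"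
    and T0: "0 \<in> T" and T1: "1 \<in> T"
    and T_add: "\<And>x y. x \<in> T \<Longrightarrow> y \<in> T \<Longrightarrow> x + y \<in> T"
    and T_mult: "\<And>x y. x \<in> T \<Longrightarrow> y \<in> T \<Longrightarrow> x * y \<in> T"
    and gT: "\<And>k. k < h \<Longrightarrow> g k \<in> T"
    and red: "\<And>f. \<exists>u\<in>T. \<pi> u \<noteq> 0 \<and> (\<exists>F\<in>T. \<exists>d. u * f = F + g h * d)"
    and free: "\<And>x t. t \<in> T \<Longrightarrow> g h * x + t = 0 \<Longrightarrow> x = 0"
  shows "generically_exact (Suc h) g"
  unfolding generically_exact_def
proof (intro allI impI)
  fix q assume q: "(\<Sum>k<Suc h. q k * g k) = 0"
  obtain u F D where u: "\<And>k. u k \<in> T" "\<And>k. \<pi> (u k) \<noteq> 0" and F: "\<And>k. F k \<in> T"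
    and uq: "\<And>k. u k * q k = F k + g h * D k"
  proof -
    have "\<forall>k. \<exists>u F d. u \<in> T \<and> \<pi> u \<noteq> 0 \<and> F \<in> T \<and> u * q k = F + g h * d" using red by blast
    then show ?thesis using that by metis
  qed
  define s where "s = (\<Prod>j<h. u j)"
  define c where "c k = (\<Prod>j\<in>{..<h} - {k}. u j)" for k
  have s: "s = c k * u k" if "k < h" for k
    using that by (simp add: s_def c_def prod.remove[of "{..<h}" k u] mult.commute)
  have T_prod: "(\<Prod>j\<in>K. u j) \<in> T" for K :: "nat set"
    by (induction K rule: infinite_finite_induct) (auto intro: T1 T_mult u)
  have T_sum: "(\<And>k. k \<in> K \<Longrightarrow> P k \<in> T) \<Longrightarrow> sum P K \<in> T" for P and K :: "nat set"
    by (induction K rule: infinite_finite_induct) (auto intro: T0 T_add)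
  have sq: "s * q k = c k * F k + g h * (c k * D k)" if "k < h" for k
    unfolding s[OF that] mult.assoc uq by (simp add: algebra_simps)
  \<comment> \<open>The syzygy multiplied by \<open>s\<close> reads \<open>g h * X + t = 0\<close>,
    where \<open>t\<close> collects the terms from \<open>T\<close> and \<open>X\<close> everything
    divisible by \<open>g h\<close>. By \<open>free\<close> both vanish.\<close>
  define t where "t = (\<Sum>k<h. c k * F k * g k)"
  define X where "X = (\<Sum>k<h. c k * D k * g k) + s * q h"
  have "t \<in> T" unfolding t_def by (intro T_sum T_mult) (auto simp: c_def T_prod F gT)
  have "s * (\<Sum>k<h. q k * g k) = (\<Sum>k<h. (c k * F k + g h * (c k * D k)) * g k)"
    by (simp add: sum_distrib_left mult.assoc[symmetric] sq)
  also have "\<dots> = t + g h * (\<Sum>k<h. c k * D k * g k)"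
    by (simp add: t_def distrib_right sum.distrib sum_distrib_left mult.assoc)
  finally have "g h * X + t = s * (\<Sum>k<Suc h. q k * g k)"
    by (simp add: X_def algebra_simps)
  then have Xt: "g h * X + t = 0" using q by simp
  with free \<open>t \<in> T\<close> have X: "X = 0" by blast
  with Xt have "t = 0" by simp
  then obtain v b where v: "\<pi> v \<noteq> 0" and b: "alternating b"
    and vF: "\<And>k. k < h \<Longrightarrow> v * (c k * F k) = (\<Sum>j<h. b k j * g j)"
    using exact[unfolded generically_exact_def, rule_format, of "\<lambda>k. c k * F k"]
    unfolding t_def by auto
  \<comment> \<open>The matrix \<open>b\<close> for the shorter sequence, bordered by a row and a
    column holding the quotients \<open>D\<close>. The equation \<open>X = 0\<close> is what makes
    the last row give \<open>q h\<close>.\<close>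
  define \<beta> where "\<beta> i j = (if i < h \<and> j < h then b i j
      else if i < h \<and> j = h then v * (c i * D i)
      else if i = h \<and> j < h then - (v * (c j * D j)) else 0)" for i j
  have "alternating \<beta>"
  proof (rule alternatingI)
    show "\<beta> i i = 0" for i by (simp add: \<beta>_def alternatingD(1)[OF b])
    show "\<beta> i j = - \<beta> j i" for i j
    proof (cases "i < h \<and> j < h")
      case True
      then have eq: "\<beta> i j = b i j" "\<beta> j i = b j i" by (simp_all add: \<beta>_def)
      show ?thesis unfolding eq by (rule alternatingD(2)[OF b])
    next
      case False
      then show ?thesis
        by (cases "i < h"; cases "j < h"; cases "i = h"; cases "j = h") (simp_all add: \<beta>_def)
    qed
  qed
  moreover have "\<pi> (v * s) \<noteq> 0" using v u by (simp add: mult s_def prod)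
  moreover have "v * s * q k = (\<Sum>j<Suc h. \<beta> k j * g j)" if "k < Suc h" for k
  proof (cases "k < h")
    case True
    then have "(\<Sum>j<Suc h. \<beta> k j * g j) = (\<Sum>j<h. b k j * g j) + v * (c k * D k) * g h"
      by (simp add: \<beta>_def)
    also have "\<dots> = v * (s * q k)"
      unfolding vF[OF True, symmetric] sq[OF True] by (simp add: algebra_simps)
    finally show ?thesis by (simp add: mult.assoc)
  next
    case False
    with that have k: "k = h" by simp
    have "(\<Sum>j<Suc h. \<beta> h j * g j) = - (v * (\<Sum>j<h. c j * D j * g j))"
      by (simp add: \<beta>_def sum_negf sum_distrib_left mult.assoc)
    also have "(\<Sum>j<h. c j * D j * g j) = - (s * q h)" using X by (simp add: X_def eq_neg_iff_add_eq_0)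
    finally show ?thesis by (simp add: k mult.assoc)
  qed
  ultimately show "\<exists>u b. \<pi> u \<noteq> 0 \<and> alternating b \<and> (\<forall>k<Suc h. u * q k = (\<Sum>j<Suc h. b k j * g j))"
    by blast
qed

end

section \<open>Elimination of variables up to denominators\<close>

lemma (in generic_point) reduce_times:
  assumes T_mult: "\<And>x y. x \<in> T \<Longrightarrow> y \<in> T \<Longrightarrow> x * y \<in> T"
    and G_add: "\<And>x y. x \<in> G \<Longrightarrow> y \<in> G \<Longrightarrow> x + y \<in> G" and G_mult: "\<And>r x. x \<in> G \<Longrightarrow> r * x \<in> G"
    and p: "u \<in> T" "\<pi> u \<noteq> 0" "F \<in> T" "u * p - F \<in> G"
    and q: "v \<in> T" "\<pi> v \<noteq> 0" "F' \<in> T" "v * q - F' \<in> G"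
  shows "\<exists>u\<in>T. \<pi> u \<noteq> 0 \<and> (\<exists>F\<in>T. u * (p * q) - F \<in> G)"
proof -
  have "(v * q) * (u * p - F) + F * (v * q - F') \<in> G"
    by (intro G_add G_mult p q)
  also have "(v * q) * (u * p - F) + F * (v * q - F') = (u * v) * (p * q) - F * F'"
    by (simp add: algebra_simps)
  finally have "u * v * (p * q) - F * F' \<in> G" .
  moreover have "\<pi> (u * v) \<noteq> 0" using p q by (simp add: mult)
  ultimately show ?thesis using p q by (intro bexI[of _ "u * v"], intro conjI bexI[of _ "F * F'"]) (auto intro: T_mult)
qed

text \<open>The denominators are kept inside \<open>T\<close> because a common denominator
  multiplies the numerators by them.\<close>

lemma (in generic_point) reduce_plus:
  assumes T_add: "\<And>x y. x \<in> T \<Longrightarrow> y \<in> T \<Longrightarrow> x + y \<in> T"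
    and T_mult: "\<And>x y. x \<in> T \<Longrightarrow> y \<in> T \<Longrightarrow> x * y \<in> T"
    and G_add: "\<And>x y. x \<in> G \<Longrightarrow> y \<in> G \<Longrightarrow> x + y \<in> G" and G_mult: "\<And>r x. x \<in> G \<Longrightarrow> r * x \<in> G"
    and p: "u \<in> T" "\<pi> u \<noteq> 0" "F \<in> T" "u * p - F \<in> G"
    and q: "v \<in> T" "\<pi> v \<noteq> 0" "F' \<in> T" "v * q - F' \<in> G"
  shows "\<exists>u\<in>T. \<pi> u \<noteq> 0 \<and> (\<exists>F\<in>T. u * (p + q) - F \<in> G)"
proof -
  have "v * (u * p - F) + u * (v * q - F') \<in> G"
    by (intro G_add G_mult p q)
  also have "v * (u * p - F) + u * (v * q - F') = (u * v) * (p + q) - (v * F + u * F')"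
    by (simp add: algebra_simps)
  finally have "u * v * (p + q) - (v * F + u * F') \<in> G" .
  moreover have "\<pi> (u * v) \<noteq> 0" using p q by (simp add: mult)
  ultimately show ?thesis
    using p q by (intro bexI[of _ "u * v"], intro conjI bexI[of _ "v * F + u * F'"]) (auto intro: T_mult T_add)
qed

text \<open>The polynomials that can be moved into the subring modulo the ideal \<open>G\<close>, up
  to a denominator, are closed under sums and products. It is therefore enough to move the variables
  in \<open>U\<close>.\<close>

lemma reduce_avoiding:
  fixes \<pi> :: "('w::finite, 'a::idom) mpoly \<Rightarrow> 'f::field"
  assumes "generic_point \<pi>"
    and G_zero: "0 \<in> G"
    and G_add: "\<And>x y. x \<in> G \<Longrightarrow> y \<in> G \<Longrightarrow> x + y \<in> G" and G_mult: "\<And>r x. x \<in> G \<Longrightarrow> r * x \<in> G"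
    and var: "\<And>w. w \<in> U \<Longrightarrow> \<exists>u\<in>avoiding U. \<pi> u \<noteq> 0 \<and>
      (\<exists>F\<in>avoiding U. u * Poly_Mapping.single (Poly_Mapping.single w 1) 1 - F \<in> G)"
  shows "\<exists>u\<in>avoiding U. \<pi> u \<noteq> 0 \<and> (\<exists>F\<in>avoiding U. u * f - F \<in> G)"
proof -
  interpret generic_point \<pi> by fact
  have triv: "\<exists>u\<in>avoiding U. \<pi> u \<noteq> 0 \<and> (\<exists>F\<in>avoiding U. u * f - F \<in> G)"
    if "f \<in> avoiding U" for f
  proof (rule bexI[of _ 1], rule conjI)
    show "\<exists>F\<in>avoiding U. 1 * f - F \<in> G" using that G_zero by (intro bexI[of _ f]) simp_all
  qed (simp_all add: one avoiding_closed)
  show ?thesis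
  proof (induction f rule: mpoly_induct)
    case (const a)
    show ?case by (rule triv) (simp add: avoiding_single)
  next
    case (var w)
    show ?case
    proof (cases "w \<in> U")
      case False
      then show ?thesis by (intro triv avoiding_single) (auto simp: lookup_single when_def)
    qed (rule assms(5))
  next
    case (plus p q)
    then show ?case
      using reduce_plus[of "avoiding U" G, OF avoiding_closed(1,3) G_add G_mult] by blast
  next
    case (times p q)
    then show ?case
      using reduce_times[of "avoiding U" G, OF avoiding_closed(3) G_add G_mult] by blast
  qed
qed

lemma mem_genideal_set:
  fixes fs :: "'s::comm_ring_1 list"
  assumes "p \<in> Idl\<^bsub>class_ring\<^esub> (set fs)"
  shows "\<exists>w. p = (\<Sum>i<length fs. w i * fs ! i)"
proof -
  let ?G = "{p. \<exists>w. p = (\<Sum>i<length fs. w i * fs ! i)}"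
  have "ideal ?G class_ring"
  proof (rule idealI)
    show R: "ring (class_ring :: 's ring)" by (rule class_ring.ring_axioms)
    show "subgroup ?G (add_monoid class_ring)"
    proof (rule group.subgroupI[OF abelian_group.a_group[OF ring.is_abelian_group[OF R]]], goal_cases)
      case 2
      show ?case by blast
    next
      case (3 p)
      then obtain w where p: "p = (\<Sum>i<length fs. w i * fs ! i)" by blast
      have "inv\<^bsub>add_monoid class_ring\<^esub> p = - p"
        unfolding a_inv_def[symmetric] by (simp only: class_ring_simps)
      also have "- p = (\<Sum>i<length fs. (- w i) * fs ! i)" by (simp add: p sum_negf)
      finally show ?case by (intro CollectI exI[of _ "\<lambda>i. - w i"])
    next
      case (4 p q)
      then obtain w w' where "p = (\<Sum>i<length fs. w i * fs ! i)" "q = (\<Sum>i<length fs. w' i * fs ! i)"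
        by blast
      then have "p \<otimes>\<^bsub>add_monoid class_ring\<^esub> q = (\<Sum>i<length fs. (w i + w' i) * fs ! i)"
        by (simp add: distrib_right sum.distrib)
      then show ?case by (intro CollectI exI[of _ "\<lambda>i. w i + w' i"])
    qed simp
  next
    fix p r :: 's assume "p \<in> ?G" "r \<in> carrier class_ring"
    then obtain w where p: "p = (\<Sum>i<length fs. w i * fs ! i)" by blast
    have "r * p = (\<Sum>i<length fs. (r * w i) * fs ! i)" by (simp add: p sum_distrib_left mult.assoc)
    then show "r \<otimes>\<^bsub>class_ring\<^esub> p \<in> ?G" "p \<otimes>\<^bsub>class_ring\<^esub> r \<in> ?G"
      by (auto simp: mult.commute[of p r])
  qed
  moreover have "set fs \<subseteq> ?G"
  proof
    fix f assume "f \<in> set fs"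
    then obtain k where k: "k < length fs" "f = fs ! k" by (auto simp: in_set_conv_nth)
    have "(\<Sum>i<length fs. (if i = k then 1 else 0) * fs ! i) = (\<Sum>i<length fs. if i = k then fs ! i else 0)"
      by (rule sum.cong) auto
    then have "f = (\<Sum>i<length fs. (if i = k then 1 else 0) * fs ! i)" using k by simp
    then show "f \<in> ?G" by (intro CollectI exI[of _ "\<lambda>i. if i = k then 1 else 0"])
  qed
  ultimately show ?thesis
    using ring.genideal_minimal[OF class_ring.ring_axioms, of ?G "set fs"] assms by blast
qed

text \<open>If \<open>s * p\<close> and \<open>s' * q\<close> are images of \<open>a\<close> and
  \<open>a'\<close> (reading \<open>s\<close>, \<open>s'\<close> as their images), then p/q is the
  image of \<open>a * s'\<close> over the image of \<open>s * a'\<close>. So the image of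
  \<open>ev\<close> already has the full fraction field of \<open>'l\<close>.\<close>

lemma generic_point_Fract:
  fixes ev :: "'s::comm_ring_1 \<Rightarrow> 'l::idom"
  assumes add: "\<And>p q. ev (p + q) = ev p + ev q" and mult: "\<And>p q. ev (p * q) = ev p * ev q"
    and one: "ev 1 = 1" and frac: "\<And>p. \<exists>s a. ev s \<noteq> 0 \<and> ev a = ev s * p"
  shows "generic_point (\<lambda>f. Fract (ev f) 1)"
proof
  fix w :: "'l fract"
  obtain p q where w: "w = Fract p q" and q: "q \<noteq> 0" by (cases w) auto
  obtain s a where s: "ev s \<noteq> 0" and a: "ev a = ev s * p" using frac by blast
  obtain s' a' where s': "ev s' \<noteq> 0" and a': "ev a' = ev s' * q" using frac by blast
  show "\<exists>b t. Fract (ev t) 1 \<noteq> 0 \<and> Fract (ev b) 1 = Fract (ev t) 1 * w"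
    by (rule exI[of _ "a * s'"], rule exI[of _ "s * a'"])
      (use q s s' in \<open>simp add: w mult a a' eq_fract Zero_fract_def mult_ac\<close>)
qed (simp_all add: add mult one One_fract_def)

lemma Fract_eq_zero_iff: "Fract (p::'l::idom) 1 = 0 \<longleftrightarrow> p = 0"
  by (simp add: Zero_fract_def eq_fract)

lemma single_eq_0_iff: "Poly_Mapping.single k c = 0 \<longleftrightarrow> c = 0"
  by (metis lookup_single_eq lookup_zero single_zero)

text \<open>The variables \<open>\<iota> v\<close> are the \<open>X\<^sub>v\<close> of the Rees algebra; \<open>\<iota>\<close> is the identity for the Rees algebra
  and \<open>Some\<close> for the extended one.\<close>

locale rees_presentation =
  fixes \<iota> :: "'v::finite \<Rightarrow> 'w::finite" and a :: "'v \<Rightarrow> 'a::idom" and v0 :: 'v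
    and x :: "'w \<Rightarrow> 'a laurent"
  assumes \<iota>: "inj \<iota>" and a0: "a v0 \<noteq> 0" and x: "x (\<iota> v) = Poly_Mapping.single 1 (a v)"
begin

abbreviation X :: "'w \<Rightarrow> ('w, 'a) mpoly" where
  "X w \<equiv> Poly_Mapping.single (Poly_Mapping.single w 1) 1"

definition Y :: "'v \<Rightarrow> ('w, 'a) mpoly" where
  "Y v = Poly_Mapping.single (Poly_Mapping.single (\<iota> v) 1) (a v0) -
    Poly_Mapping.single (Poly_Mapping.single (\<iota> v0) 1) (a v)"

definition \<pi> :: "('w, 'a) mpoly \<Rightarrow> 'a laurent fract" where
  "\<pi> f = Fract (laurent_eval x f) 1"

lemma \<pi>_eq_0_iff: "\<pi> f = 0 \<longleftrightarrow> laurent_eval x f = 0"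
  unfolding \<pi>_def by (rule Fract_eq_zero_iff)

text \<open>Since \<open>X (\<iota> v0)\<close> maps to \<open>a v0\<close> times t, both t and its
  inverse are quotients of images. The argument does not ask whether the image contains the inverse
  of t, so it serves both Rees algebras.\<close>

lemma laurent_common_denominator: "\<exists>s b. laurent_eval x s \<noteq> 0 \<and> laurent_eval x b = laurent_eval x s * p"
proof (induction p rule: laurent_induct)
  case (const c)
  show ?case
    by (rule exI[of _ 1], rule exI[of _ "Poly_Mapping.single 0 c"])
      (simp add: laurent_eval_const laurent_eval_const[of x 1, simplified])
next
  case t
  show ?case
    by (rule exI[of _ "Poly_Mapping.single 0 (a v0)"], rule exI[of _ "X (\<iota> v0)"])
      (use a0 in \<open>simp only: laurent_eval_const laurent_eval_var x mult_single, simp add: single_eq_0_iff\<close>)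
next
  case t_inv
  show ?case
    by (rule exI[of _ "X (\<iota> v0)"], rule exI[of _ "Poly_Mapping.single 0 (a v0)"])
      (use a0 in \<open>simp only: laurent_eval_const laurent_eval_var x mult_single, simp add: single_eq_0_iff\<close>)
next
  case (plus p q)
  then obtain s b s' b' where "laurent_eval x s \<noteq> 0" "laurent_eval x b = laurent_eval x s * p"
    "laurent_eval x s' \<noteq> 0" "laurent_eval x b' = laurent_eval x s' * q" by blast
  note sb = this
  show ?case
    by (rule exI[of _ "s * s'"], rule exI[of _ "s' * b + s * b'"])
      (simp add: sb laurent_eval_add laurent_eval_mult algebra_simps)
next
  case (times p q)
  then obtain s b s' b' where "laurent_eval x s \<noteq> 0" "laurent_eval x b = laurent_eval x s * p"
    "laurent_eval x s' \<noteq> 0" "laurent_eval x b' = laurent_eval x s' * q" by blast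
  note sb = this
  show ?case
    by (rule exI[of _ "s * s'"], rule exI[of _ "b * b'"]) (simp add: sb laurent_eval_mult mult_ac)
qed

sublocale generic_point \<pi>
  unfolding \<pi>_def
  by (rule generic_point_Fract[OF laurent_eval_add laurent_eval_mult _ laurent_common_denominator])
    (simp add: laurent_eval_const[of x 1, simplified])

lemma \<pi>_const: "\<pi> (Poly_Mapping.single 0 c) = 0 \<longleftrightarrow> c = 0"
  unfolding \<pi>_eq_0_iff laurent_eval_const by (rule single_eq_0_iff)

lemma \<pi>_X0: "\<pi> (X (\<iota> v0)) \<noteq> 0"
  unfolding \<pi>_eq_0_iff laurent_eval_var x using a0 by (simp add: single_eq_0_iff)

lemma \<pi>_Y: "\<pi> (Y v) = 0"
proof -
  have ev: "laurent_eval x (Poly_Mapping.single (Poly_Mapping.single (\<iota> u) 1) c) = Poly_Mapping.single 1 (c * a u)"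
    for u c
  proof -
    have "Poly_Mapping.single (Poly_Mapping.single (\<iota> u) 1) c = Poly_Mapping.single 0 c * X (\<iota> u)"
      by (simp add: mult_single)
    then show ?thesis
      by (simp only: laurent_eval_mult laurent_eval_const laurent_eval_var x) (simp add: mult_single)
  qed
  have "\<pi> (Y v) = \<pi> (Poly_Mapping.single (Poly_Mapping.single (\<iota> v) 1) (a v0)) -
      \<pi> (Poly_Mapping.single (Poly_Mapping.single (\<iota> v0) 1) (a v))"
    unfolding Y_def by (rule diff)
  then show ?thesis unfolding \<pi>_def ev by (simp add: mult.commute)
qed

lemma Y_avoiding: "v' \<noteq> v \<Longrightarrow> v' \<noteq> v0 \<Longrightarrow> Y v \<in> avoiding {\<iota> v'}"
  unfolding Y_def
  by (intro avoiding_closed(2) avoiding_single) (auto simp: lookup_single when_def dest: injD[OF \<iota>])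

text \<open>Modulo \<open>Y v\<close> the variable at \<open>v\<close> equals
  \<open>a v / a v0\<close> times the variable at \<open>v0\<close>; the denominator is the constant
  \<open>a v0\<close>.\<close>

lemma reduce_Y:
  assumes "Poly_Mapping.single (Poly_Mapping.single (\<iota> v0) 1) (a v) \<in> avoiding U" "Y v \<in> G"
  shows "\<exists>u\<in>avoiding U. \<pi> u \<noteq> 0 \<and> (\<exists>F\<in>avoiding U. u * X (\<iota> v) - F \<in> G)"
  using assms a0
  by (intro bexI[of _ "Poly_Mapping.single 0 (a v0)"] conjI
      bexI[of _ "Poly_Mapping.single (Poly_Mapping.single (\<iota> v0) 1) (a v)"])
    (simp_all add: \<pi>_const mult_single Y_def avoiding_single)

text \<open>\<open>Y v\<close> is linear in the variable at \<open>v\<close> with nonzero leading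
  coefficient \<open>a v0\<close>. It eliminates that variable, and by the leading term argument its
  nonzero multiples never lie in the subring without it.\<close>

lemma generically_exact_Y:
  assumes exact: "generically_exact h g" and gh: "g h = Y v" and v: "v \<noteq> v0"
    and g: "\<And>k. k < h \<Longrightarrow> g k \<in> avoiding {\<iota> v}"
  shows "generically_exact (Suc h) g"
proof (rule generically_exact_Suc[OF exact, of "avoiding {\<iota> v}"])
  have ne: "\<iota> v \<noteq> \<iota> v0" using \<iota> v by (auto dest: injD)
  have av: "Poly_Mapping.single (Poly_Mapping.single (\<iota> v0) 1) (a v) \<in> avoiding {\<iota> v}"
    using ne by (intro avoiding_single) (simp add: lookup_single)
  show "\<exists>u\<in>avoiding {\<iota> v}. \<pi> u \<noteq> 0 \<and> (\<exists>F\<in>avoiding {\<iota> v}. \<exists>d. u * f = F + g h * d)" for f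
  proof -
    have "\<exists>u\<in>avoiding {\<iota> v}. \<pi> u \<noteq> 0 \<and> (\<exists>F\<in>avoiding {\<iota> v}. u * f - F \<in> {p. Y v dvd p})"
    proof (rule reduce_avoiding[OF generic_point_axioms])
      show "\<exists>u\<in>avoiding {\<iota> v}. \<pi> u \<noteq> 0 \<and> (\<exists>F\<in>avoiding {\<iota> v}. u * X w - F \<in> {p. Y v dvd p})"
        if "w \<in> {\<iota> v}" for w
        using reduce_Y[OF av, of "{p. Y v dvd p}"] that by simp
    qed auto
    then obtain u F where u: "u \<in> avoiding {\<iota> v}" "\<pi> u \<noteq> 0" and F: "F \<in> avoiding {\<iota> v}"
      and "Y v dvd u * f - F" by blast
    then obtain d where "u * f - F = Y v * d" by (auto elim: dvdE)
    then have "u * f = F + g h * d" by (simp add: gh algebra_simps)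
    then show ?thesis using u F by blast
  qed
  show "p = 0" if t: "t \<in> avoiding {\<iota> v}" and eq: "g h * p + t = 0" for p t
  proof (rule leading_term_cancel)
    show "(Poly_Mapping.single (Poly_Mapping.single (\<iota> v) 1) (a v0) -
        Poly_Mapping.single (Poly_Mapping.single (\<iota> v0) 1) (a v)) * p + t = 0"
      using eq unfolding gh Y_def .
  qed (use a0 ne t in \<open>auto simp: lookup_single when_def avoiding_def\<close>)
qed (auto simp: avoiding_closed g)

text \<open>Each \<open>Y v\<close> involves only the variables at \<open>v\<close> and
  \<open>v0\<close>, so the earlier entries avoid the variable to be eliminated next. The prefix of
  length \<open>h\<close> leaves room for the additional relation of the extended algebra.\<close>

lemma generically_exact_Ys:
  assumes exact: "generically_exact h g" and vs: "distinct vs" "v0 \<notin> set vs"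
    and g: "\<And>k v. k < h \<Longrightarrow> v \<in> set vs \<Longrightarrow> g k \<in> avoiding {\<iota> v}"
    and Y: "\<And>k. k < length vs \<Longrightarrow> g (h + k) = Y (vs ! k)"
  shows "generically_exact (h + length vs) g"
proof -
  have "generically_exact (h + r) g" if "r \<le> length vs" for r
    using that
  proof (induction r)
    case (Suc r)
    then have r: "r < length vs" by simp
    have "g k \<in> avoiding {\<iota> (vs ! r)}" if "k < h + r" for k
    proof (cases "k < h")
      case False
      define j where "j = k - h"
      have j: "k = h + j" "j < r" using False that by (simp_all add: j_def)
      then have "vs ! r \<noteq> vs ! j" using vs(1) r by (simp add: nth_eq_iff_index_eq)
      moreover have "vs ! r \<noteq> v0" using vs(2) r nth_mem by metis
      ultimately show ?thesis using Y[of j] j r Y_avoiding by simp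
    qed (use g r in simp)
    then show ?case
      using generically_exact_Y[of "h + r" g "vs ! r"] Suc Y[OF r] vs(2) r nth_mem by (metis add_Suc_right Suc_leD)
  qed (use exact in simp)
  then show ?thesis by simp
qed

text \<open>The relations eliminate every variable except the one at \<open>v0\<close>;
  \<open>other\<close> does this for the variable T. What remains of an element of the kernel is a
  polynomial in one variable on which evaluation is injective.\<close>

lemma kernel_generated:
  assumes g: "\<And>k. k < H \<Longrightarrow> \<pi> (g k) = 0"
    and Y: "\<And>v. v \<noteq> v0 \<Longrightarrow> \<exists>k<H. g k = Y v"
    and other: "\<And>w. w \<notin> range \<iota> \<Longrightarrow> \<exists>k<H. \<exists>u\<in>avoiding (- {\<iota> v0}). \<pi> u \<noteq> 0 \<and>
      (\<exists>F\<in>avoiding (- {\<iota> v0}). u * X w - F = g k)"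
    and p: "\<pi> p = 0"
  shows "\<exists>s m. \<pi> s \<noteq> 0 \<and> s * p = (\<Sum>k<(H::nat). m k * g k)"
proof -
  let ?U = "- {\<iota> v0}"
  define G where "G = {q. \<exists>m. q = (\<Sum>k<H. m k * g k)}"
  have g_mem: "g k \<in> G" if "k < H" for k
  proof -
    have "(\<Sum>j<H. (if j = k then 1 else 0) * g j) = (\<Sum>j<H. if j = k then g j else 0)"
      by (rule sum.cong) auto
    also have "\<dots> = g k" using that by simp
    finally show ?thesis
      unfolding G_def by (intro CollectI exI[of _ "\<lambda>j. if j = k then 1 else 0"]) (rule sym)
  qed
  have G_add: "q + r \<in> G" if qr: "q \<in> G" "r \<in> G" for q r
  proof -
    obtain m m' where "q = (\<Sum>k<H. m k * g k)" "r = (\<Sum>k<H. m' k * g k)"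
      using qr unfolding G_def by blast
    then have "q + r = (\<Sum>k<H. (m k + m' k) * g k)" by (simp add: distrib_right sum.distrib)
    then show ?thesis unfolding G_def by (intro CollectI exI[of _ "\<lambda>k. m k + m' k"])
  qed
  have G_mult: "r * q \<in> G" if q: "q \<in> G" for q r
  proof -
    obtain m where "q = (\<Sum>k<H. m k * g k)" using q unfolding G_def by blast
    then have "r * q = (\<Sum>k<H. (r * m k) * g k)" by (simp add: sum_distrib_left mult.assoc)
    then show ?thesis unfolding G_def by (intro CollectI exI[of _ "\<lambda>k. r * m k"])
  qed
  have "\<exists>u\<in>avoiding ?U. \<pi> u \<noteq> 0 \<and> (\<exists>F\<in>avoiding ?U. u * p - F \<in> G)"
  proof (rule reduce_avoiding[OF generic_point_axioms _ G_add G_mult])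
    show "0 \<in> G" unfolding G_def by (intro CollectI exI[of _ "\<lambda>_. 0"]) simp
    show "\<exists>u\<in>avoiding ?U. \<pi> u \<noteq> 0 \<and> (\<exists>F\<in>avoiding ?U. u * X w - F \<in> G)" if "w \<in> ?U" for w
    proof (cases "w \<in> range \<iota>")
      case True
      then obtain v where w: "w = \<iota> v" by blast
      with that have "v \<noteq> v0" by auto
      then obtain k where "k < H" "g k = Y v" using Y by blast
      then have "Y v \<in> G" using g_mem by metis
      then show ?thesis
        unfolding w by (intro reduce_Y avoiding_single) (auto simp: lookup_single when_def)
    next
      case False
      from other[OF this] obtain k u F where k: "k < H" and u: "u \<in> avoiding ?U" "\<pi> u \<noteq> 0"
        and F: "F \<in> avoiding ?U" and eq: "u * X w - F = g k" by blast
      have "u * X w - F \<in> G" unfolding eq by (rule g_mem[OF k])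
      with u F show ?thesis by blast
    qed
  qed
  then obtain u F where u: "\<pi> u \<noteq> 0" and F: "F \<in> avoiding ?U" and "u * p - F \<in> G" by blast
  then obtain m where m: "u * p - F = (\<Sum>k<H. m k * g k)" unfolding G_def by blast
  have "\<pi> (u * p - F) = 0" unfolding m by (simp add: hom_simps g)
  then have "\<pi> F = 0" using p by (simp add: hom_simps)
  then have "F = 0"
    using laurent_eval_inj_on_one_variable[of F "\<iota> v0" x "a v0", OF F x a0] by (simp add: \<pi>_eq_0_iff)
  with m u show ?thesis by auto
qed

lemma rank_koszul_homology_kernel:
  assumes g: "\<And>k. k < H \<Longrightarrow> \<pi> (g k) = 0" and exact: "generically_exact H g"
    and Y: "\<And>v. v \<noteq> v0 \<Longrightarrow> \<exists>k<H. g k = Y v"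
    and other: "\<And>w. w \<notin> range \<iota> \<Longrightarrow> \<exists>k<H. \<exists>u\<in>avoiding (- {\<iota> v0}). \<pi> u \<noteq> 0 \<and>
      (\<exists>F\<in>avoiding (- {\<iota> v0}). u * X w - F = g k)"
    and fs: "Idl\<^bsub>class_ring\<^esub> (set fs) = {p. \<pi> p = 0}"
  shows "module_rank (class_ring Quot {p. \<pi> p = 0}) (koszul_homology fs 1) + H = length fs"
proof -
  have f_mem: "\<pi> (fs ! i) = 0" if "i < length fs" for i
    using ring.genideal_self[OF class_ring.ring_axioms, of "set fs"] that unfolding fs by (auto simp: subset_iff)
  have "\<exists>s m. \<pi> s \<noteq> 0 \<and> s * fs ! i = (\<Sum>k<H. m k * g k)" if "i < length fs" for i
    by (rule kernel_generated[OF g Y other f_mem[OF that]])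
  then obtain s m where s: "\<And>i. i < length fs \<Longrightarrow> \<pi> (s i) \<noteq> 0"
    and m: "\<And>i. i < length fs \<Longrightarrow> s i * fs ! i = (\<Sum>k<H. m i k * g k)" by metis
  \<comment> \<open>Each generator comes with its own denominator; their product gives the single
    multiplier that the presentation requires.\<close>
  obtain S c where S: "\<pi> S \<noteq> 0" and c: "\<And>i. i < length fs \<Longrightarrow> S = c i * s i"
    using common_multiple[of "length fs" s] s by blast
  interpret koszul_point \<pi> fs H g S "\<lambda>i k. c i * m i k"
  proof
    show "\<exists>w. p = (\<Sum>i<length fs. w i * fs ! i)" if "\<pi> p = 0" for p
      using that fs mem_genideal_set by blast
    show "S * fs ! i = (\<Sum>k<H. c i * m i k * g k)" if "i < length fs" for i
      unfolding c[OF that] by (simp add: mult.assoc m[OF that] sum_distrib_left)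
  qed (use f_mem g exact S in auto)
  show ?thesis using rank_koszul_homology by simp
qed

end

section \<open>The rank formulas for the two Rees algebras\<close>

lemma rees_ideal_eq:
  "rees_ideal I a = {p. laurent_eval (\<lambda>v. Poly_Mapping.single 1 (a v)) p = 0}"
  "ext_rees_ideal I a = {p. laurent_eval
     (case_option (Poly_Mapping.single (- 1) 1) (\<lambda>v. Poly_Mapping.single 1 (a v))) p = 0}"
  by (simp_all add: rees_ideal_def ext_rees_ideal_def rees_algebra_def ext_rees_algebra_def
      a_kernel_def kernel_def)

lemma card_UNIV_distinct:
  assumes vs: "set vs = - {v0 :: 'v::finite}" "distinct vs"
  shows "card (UNIV :: 'v set) = Suc (length vs)"
proof -
  have "UNIV = insert v0 (set vs)" using vs(1) by auto
  moreover have "v0 \<notin> set vs" using vs(1) by simp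
  ultimately show ?thesis using distinct_card[OF vs(2)] by (metis List.finite_set card_insert_disjoint)
qed

text \<open>With \<iota> the identity there is no further variable, so \<open>other\<close> is
  vacuous and the sequence consists of one \<open>Y v\<close> for each \<open>v\<close> different
  from \<open>v0\<close>.\<close>

lemma rank_koszul_homology_rees:
  fixes a :: "'v::finite \<Rightarrow> 'a::idom"
  assumes a0: "a v0 \<noteq> 0" and fs: "Idl\<^bsub>class_ring\<^esub> (set fs) = rees_ideal I a"
  shows "module_rank (class_ring Quot rees_ideal I a) (koszul_homology fs 1) + card (UNIV :: 'v set)
    = length fs + 1"
proof -
  interpret rees_presentation id a v0 "\<lambda>v. Poly_Mapping.single 1 (a v)"
    by standard (simp_all add: a0)
  have J: "rees_ideal I a = {p. \<pi> p = 0}" by (simp add: rees_ideal_eq \<pi>_eq_0_iff)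
  obtain vs where vs: "set vs = - {v0}" "distinct vs" using finite_distinct_list[of "- {v0}"] by auto
  have "module_rank (class_ring Quot {p. \<pi> p = 0}) (koszul_homology fs 1) + length vs = length fs"
  proof (rule rank_koszul_homology_kernel)
    show "generically_exact (length vs) (\<lambda>k. Y (vs ! k))"
      using generically_exact_Ys[of 0 "\<lambda>k. Y (vs ! k)" vs] vs generically_exact_0 by simp
    show "\<exists>k<length vs. Y (vs ! k) = Y v" if "v \<noteq> v0" for v
    proof -
      from that vs have "v \<in> set vs" by simp
      then show ?thesis by (metis in_set_conv_nth)
    qed
  qed (use fs in \<open>simp_all add: \<pi>_Y J\<close>)
  moreover have "card (UNIV :: 'v set) = length vs + 1"
    using card_UNIV_distinct[OF vs] by simp
  ultimately show ?thesis unfolding J by simp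
qed

lemma rank_koszul_homology_ext_rees:
  fixes a :: "'v::finite \<Rightarrow> 'a::idom"
  assumes a0: "a v0 \<noteq> 0" and fs: "Idl\<^bsub>class_ring\<^esub> (set fs) = ext_rees_ideal I a"
  shows "module_rank (class_ring Quot ext_rees_ideal I a) (koszul_homology fs 1) + card (UNIV :: 'v set)
    = length fs"
proof -
  interpret rees_presentation Some a v0
    "case_option (Poly_Mapping.single (- 1) 1) (\<lambda>v. Poly_Mapping.single 1 (a v))"
    by standard (simp_all add: a0)
  let ?x = "case_option (Poly_Mapping.single (- 1) 1) (\<lambda>v. Poly_Mapping.single 1 (a v))"
  have J: "ext_rees_ideal I a = {p. \<pi> p = 0}" by (simp add: rees_ideal_eq \<pi>_eq_0_iff)
  obtain vs where vs: "set vs = - {v0}" "distinct vs" using finite_distinct_list[of "- {v0}"] by auto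
  define k0 :: "'v option \<Rightarrow>\<^sub>0 nat" where
    "k0 = Poly_Mapping.single (Some v0) 1 + Poly_Mapping.single None 1"
  define t where "t = Poly_Mapping.single k0 1 - Poly_Mapping.single 0 (a v0)"
  \<comment> \<open>The relation \<open>t\<close>, that is X_v0 T - a(v0), comes first: it contains
    none of the variables that the later \<open>Y v\<close> eliminate.\<close>
  define g where "g k = (case k of 0 \<Rightarrow> t | Suc j \<Rightarrow> Y (vs ! j))" for k
  have t: "t = X (Some v0) * X None - Poly_Mapping.single 0 (a v0)"
    by (simp add: t_def k0_def mult_single)
  have "\<pi> (X (Some v0) * X None) = \<pi> (Poly_Mapping.single 0 (a v0))"
    unfolding \<pi>_def laurent_eval_mult laurent_eval_var laurent_eval_const by (simp add: mult_single)
  then have \<pi>t: "\<pi> t = 0" unfolding t diff by simp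
  \<comment> \<open>The leading term is taken with respect to T: the monomial \<open>k0\<close>
    contains \<open>None\<close>, the constant term does not.\<close>
  have t_free: "p = 0" if "t * p = 0" for p
  proof (rule leading_term_cancel)
    show "(Poly_Mapping.single k0 1 - Poly_Mapping.single 0 (a v0)) * p + 0 = 0"
      using that by (simp add: t_def)
    show "Poly_Mapping.lookup 0 None < Poly_Mapping.lookup k0 None"
      by (simp add: k0_def lookup_add lookup_single)
  qed simp_all
  have "generically_exact 1 g"
    unfolding generically_exact_def
  proof (intro allI impI)
    fix q assume "(\<Sum>k<1. q k * g k) = 0"
    then have "t * q 0 = 0" by (simp add: g_def mult.commute)
    from t_free[OF this] have "q 0 = 0" .
    then show "\<exists>u b. \<pi> u \<noteq> 0 \<and> alternating b \<and> (\<forall>k<1. u * q k = (\<Sum>j<1. b k j * g j))"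
      by (intro exI[of _ 1] exI[of _ "\<lambda>_ _. 0"]) (simp add: one alternating_def)
  qed
  moreover have "t \<in> avoiding {Some v}" if "v \<noteq> v0" for v
    unfolding t_def k0_def using that
    by (intro avoiding_closed(2) avoiding_single) (auto simp: lookup_add lookup_single)
  ultimately have exact: "generically_exact (1 + length vs) g"
    using vs by (intro generically_exact_Ys) (auto simp: g_def)
  have "module_rank (class_ring Quot {p. \<pi> p = 0}) (koszul_homology fs 1) + (1 + length vs) = length fs"
  proof (rule rank_koszul_homology_kernel[OF _ exact])
    show "\<pi> (g k) = 0" for k by (simp add: g_def \<pi>_Y \<pi>t split: nat.split)
    show "\<exists>k<1 + length vs. g k = Y v" if "v \<noteq> v0" for v
    proof -
      from that vs have "v \<in> set vs" by simp
      then obtain j where "j < length vs" "vs ! j = v" by (metis in_set_conv_nth)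
      then show ?thesis by (intro exI[of _ "Suc j"]) (simp add: g_def)
    qed
    show "\<exists>k<1 + length vs. \<exists>u\<in>avoiding (- {Some v0}). \<pi> u \<noteq> 0 \<and>
        (\<exists>F\<in>avoiding (- {Some v0}). u * X w - F = g k)" if "w \<notin> range Some" for w
    proof -
      \<comment> \<open>Modulo \<open>t\<close> the variable T equals \<open>a v0\<close> divided by
        the variable at \<open>v0\<close>, which provides the required denominator.\<close>
      have "w = None" using that by (cases w) auto
      then have "X (Some v0) * X w - Poly_Mapping.single 0 (a v0) = g 0" by (simp only: g_def t nat.case)
      moreover have "X (Some v0) \<in> avoiding (- {Some v0})"
        by (rule avoiding_single) (auto simp: lookup_single)
      moreover have "Poly_Mapping.single 0 (a v0) \<in> avoiding (- {Some v0})"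
        by (rule avoiding_single) simp
      moreover have "0 < 1 + length vs" by simp
      ultimately show ?thesis using \<pi>_X0 by blast
    qed
    show "Idl\<^bsub>class_ring\<^esub> (set fs) = {p. \<pi> p = 0}" using fs unfolding J .
  qed
  moreover have "card (UNIV :: 'v set) = 1 + length vs"
    using card_UNIV_distinct[OF vs] by simp
  ultimately show ?thesis unfolding J by simp
qed

theorem theorem1p6:
  fixes \<mm> I :: "'a::idom set" and d :: nat and a :: "'v::finite \<Rightarrow> 'a"
  assumes "cohen_macaulay_local (class_ring :: 'a ring) \<mm>"
    and "krull_dim (class_ring :: 'a ring) = enat d" and "d \<ge> 1"
    and "ideal I class_ring" and "I \<noteq> {0}"
    and "Idl\<^bsub>class_ring\<^esub> (range a) = I"
    and "card (UNIV :: 'v set) = min_num_gens class_ring UNIV I"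
  shows
    "(\<forall>fs. min_gen_system class_ring ext_rees_homogeneous (ext_rees_ideal I a) fs \<longrightarrow>
        int (module_rank (class_ring Quot ext_rees_ideal I a) (koszul_homology fs 1)) =
        int (min_num_gens class_ring ext_rees_homogeneous (ext_rees_ideal I a))
          - int (min_num_gens class_ring UNIV I)) \<and>
     (\<forall>fs. min_gen_system class_ring rees_homogeneous (rees_ideal I a) fs \<longrightarrow>
        int (module_rank (class_ring Quot rees_ideal I a) (koszul_homology fs 1)) =
        int (min_num_gens class_ring rees_homogeneous (rees_ideal I a))
          - int (min_num_gens class_ring UNIV I) + 1)"
proof -
  \<comment> \<open>A nonzero ideal has a nonzero generator, which serves as the pivot
    \<open>a v0\<close>.\<close>
  have "\<exists>v. a v \<noteq> 0"
  proof (rule ccontr)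
    assume "\<nexists>v. a v \<noteq> 0"
    then have "Idl\<^bsub>class_ring\<^esub> (range a) \<subseteq> {0}"
      using ring.genideal_minimal[OF class_ring.ring_axioms, of "{0}" "range a"]
        ring.zeroideal[OF class_ring.ring_axioms] by auto
    moreover have "(0::'a) \<in> I" using additive_subgroup.zero_closed[OF ideal.axioms(1)[OF assms(4)]] by simp
    ultimately show False using assms(5,6) by auto
  qed
  then obtain v0 where v0: "a v0 \<noteq> 0" by blast
  \<comment> \<open>For a minimal system \<open>length fs\<close> is the minimal number of
    homogeneous generators, and the number of variables X_v is that of \<open>I\<close>; the rank
    formulas then give both equations over the integers.\<close>
  show ?thesis
    using rank_koszul_homology_rees[of a v0, OF v0, where I = I]
      rank_koszul_homology_ext_rees[of a v0, OF v0, where I = I]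
    by (fastforce simp: min_gen_system_def assms(7)[symmetric])
qed

end
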